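(* Let $\Omega\subset\mathbb{C}^s$ be open and let $F=\{f_1,\dots,f_t\}$ be a system of functions that are analytic in $\Omega$. Let $\hat{\mathbf{x}}\in\Omega$ be a zero of $F$. Then $\hat{\mathbf{x}}$ is an isolated zero of $F$ if and only if $\sup_{\alpha\ge 0}\{\dim \mathcal{D}^\alpha_{\hat{\mathbf{x}}}(F)\}$ is finite.
   Context: A zero $\hat{\mathbf{x}}$ of $F$ is a common zero of $f_1,\dots,f_t$. It is isolated if there is a neighborhood $\Delta$ of $\hat{\mathbf{x}}$ in $\mathbb{C}^s$ in which $\hat{\mathbf{x}}$ is the only zero of $F$. A function is analytic in an open set if it possesses a power series expansion converging to it at every point of the set. Differential functionals. For $\mathbf{j}=(j_1,\dots,j_s)$ with nonnegative integer entries write $|\mathbf{j}|=j_1+\cdots+j_s$ and $$\partial_{\mathbf{j}}[\hat{\mathbf{x}}](f)=\frac{1}{j_1!\cdots j_s!}\,\frac{\partial^{|\mathbf{j}|}f}{\partial x_1^{j_1}\cdots\partial x_s^{j_s}}(\hat{\mathbf{x}});$$ by convention $\partial_{\mathbf{j}}[\hat{\mathbf{x}}]=0$ if some $j_i<0$. A differential functional at $\hat{\mathbf{x}}$ is a finite complex linear combination $c=\sum_{\mathbf{j}} c_{\mathbf{j}}\partial_{\mathbf{j}}[\hat{\mathbf{x}}]$ (a formal linear combination of the symbols $\partial_{\mathbf{j}}[\hat{\mathbf{x}}]$). We write $c(F)=\{c(f_1),\dots,c(f_t)\}$. For $i=1,\dots,s$, the linear anti-differentiation map $\phi_i$ is defined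 by $\phi_i(\partial_{j_1\cdots j_s}[\hat{\mathbf{x}}])=\partial_{j_1'\cdots j_s'}[\hat{\mathbf{x}}]$ with $j_i'=j_i-1$ and $j_\sigma'=j_\sigma$ for $\sigma\neq i$. Dual subspaces. $\mathcal{D}^0_{\hat{\mathbf{x}}}(F)=\mathrm{span}\{\partial_{0\cdots0}[\hat{\mathbf{x}}]\}$ and, for $\alpha\ge1$, $$\mathcal{D}^\alpha_{\hat{\mathbf{x}}}(F)=\Big\{c=\sum_{|\mathbf{j}|\le\alpha}c_{\mathbf{j}}\partial_{\mathbf{j}}[\hat{\mathbf{x}}]\ :\ c(F)=\{0\},\ \phi_i(c)\in\mathcal{D}^{\alpha-1}_{\hat{\mathbf{x}}}(F)\ \text{for all } i=1,\dots,s\Big\}.$$ *)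

theory Defs
  imports
    "HOL-Analysis.Analysis"
    "HOL-Library.Poly_Mapping"
    "HOL-Library.Extended_Nat"
begin

type_synonym 's multiindex = "'s \<Rightarrow> nat"

text \<open>
  The coordinates of \<open>\<complex>\<^sup>s\<close> are indexed by a finite, linearly ordered type \<open>'s\<close> (so
  \<open>s = CARD('s)\<close>). The order only fixes the sequence in which partial derivatives are
  iterated.

  A family over all multi-indices \<open>'s \<Rightarrow> nat\<close> has no canonical enumeration, so convergence of a
  multivariate power series is unconditional (equivalently, absolute) convergence.
\<close>

definition mv_analytic_on :: "(complex ^ 's::finite \<Rightarrow> complex) \<Rightarrow> (complex ^ 's) set \<Rightarrow> bool"
    (infixl \<open>mv'_analytic'_on\<close> 50) where
  "f mv_analytic_on \<Omega> \<longleftrightarrow>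
    (\<forall>a\<in>\<Omega>. \<exists>c :: 's multiindex \<Rightarrow> complex.
      \<forall>\<^sub>F x in nhds a. ((\<lambda>j. c j * (\<Prod>i\<in>UNIV. (x $ i - a $ i) ^ j i)) has_sum f x) UNIV)"

definition common_zeros ::
    "(complex ^ 's) set \<Rightarrow> (complex ^ 's \<Rightarrow> complex) set \<Rightarrow> (complex ^ 's) set" where
  "common_zeros \<Omega> F = {x \<in> \<Omega>. \<forall>f\<in>F. f x = 0}"

definition partial_deriv ::
    "'s \<Rightarrow> (complex ^ 's::finite \<Rightarrow> complex) \<Rightarrow> complex ^ 's \<Rightarrow> complex" where
  "partial_deriv i f x = deriv (\<lambda>z. f (\<chi> k. if k = i then z else x $ k)) (x $ i)"

definition mixed_partial ::
    "'s multiindex \<Rightarrow> (complex ^ 's::{finite,linorder} \<Rightarrow> complex) \<Rightarrow> complex ^ 's::{finite,linorder} \<Rightarrow> complex" where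
  "mixed_partial j f = foldr (\<lambda>i. partial_deriv i ^^ j i) (sorted_list_of_set UNIV) f"

definition diff_op ::
    "'s multiindex \<Rightarrow> complex ^ 's::{finite,linorder} \<Rightarrow> (complex ^ 's::{finite,linorder} \<Rightarrow> complex) \<Rightarrow> complex" where
  "diff_op j x f = mixed_partial j f x / (\<Prod>i\<in>UNIV. fact (j i))"

text \<open>
  A differential functional is a \<^emph>\<open>formal\<close> finite linear combination of the symbols
  \<open>\<partial>\<^sub>j[x]\<close>, represented by its finitely supported coefficient family. The base point \<open>x\<close> is not
  part of the data; it enters only when the functional is applied to a function.
\<close>

type_synonym 's diff_functional = "'s multiindex \<Rightarrow>\<^sub>0 complex"

definition scale_functional ::
    "complex \<Rightarrow> 's diff_functional \<Rightarrow> 's diff_functional" where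
  "scale_functional a = Poly_Mapping.map ((*) a)"

lemma lookup_scale_functional [simp]:
  "Poly_Mapping.lookup (scale_functional a c) j = a * Poly_Mapping.lookup c j"
  by (auto simp: scale_functional_def Poly_Mapping.map.rep_eq when_def)

global_interpretation functional: vector_space scale_functional
  by unfold_locales
    (auto intro!: poly_mapping_eqI simp: lookup_add distrib_left distrib_right)

definition apply_functional ::
    "'s diff_functional \<Rightarrow> complex ^ 's::{finite,linorder} \<Rightarrow> (complex ^ 's::{finite,linorder} \<Rightarrow> complex) \<Rightarrow> complex" where
  "apply_functional c x f =
    (\<Sum>j\<in>Poly_Mapping.keys c. Poly_Mapping.lookup c j * diff_op j x f)"

text \<open>The case \<open>j i = 0\<close> is the convention that \<open>\<partial>\<^sub>j[x] = 0\<close> when an entry of \<open>j\<close> is negative.\<close>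

definition anti_diff :: "'s \<Rightarrow> 's diff_functional \<Rightarrow> 's diff_functional" where
  "anti_diff i c =
    (\<Sum>j\<in>Poly_Mapping.keys c.
      if j i = 0 then 0
      else Poly_Mapping.single (j(i := j i - 1)) (Poly_Mapping.lookup c j))"

primrec dual_space ::
    "complex ^ 's::{finite,linorder} \<Rightarrow> (complex ^ 's::{finite,linorder} \<Rightarrow> complex) set \<Rightarrow> nat
      \<Rightarrow> 's diff_functional set" where
  "dual_space x F 0 = functional.span {Poly_Mapping.single (\<lambda>_. 0) 1}"
| "dual_space x F (Suc \<alpha>) =
    {c. (\<forall>j\<in>Poly_Mapping.keys c. (\<Sum>i\<in>UNIV. j i) \<le> Suc \<alpha>) \<and>
        apply_functional c x ` F = {0} \<and>
        (\<forall>i. anti_diff i c \<in> dual_space x F \<alpha>)}"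

text \<open>
  Each \<open>dual_space x F \<alpha>\<close> lies in the span of the finitely many symbols of order at most \<open>\<alpha>\<close>, so the
  value \<open>0\<close> that \<open>dim\<close> takes on infinite-dimensional spaces never arises for these spaces.
\<close>

end

theory Submission
  imports Defs
begin

text \<open>
  Write \<open>f = \<Sum>\<^sub>j \<phi>\<^sub>j y\<^sup>j\<close> for the Taylor series of \<open>f \<in> F\<close> at the zero, with \<open>y\<close> the displacement
  from it. Since \<open>\<phi>\<^sub>j\<close> is the value of the symbol \<open>\<partial>\<^sub>j\<close> on \<open>f\<close> (\<open>diff_op_eq_coefficient\<close>), and
  since antidifferentiation is a shift of the coefficient family, the space \<open>\<D>\<^sup>\<alpha>\<close> consists of the
  families \<open>c\<close> of order at most \<open>\<alpha>\<close> with \<open>\<Sum>\<^sub>j c\<^sub>j\<^sub>+\<^sub>m \<phi>\<^sub>j = 0\<close> for all \<open>m\<close> and \<open>f\<close>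
  (\<open>dual_space_iff\<close>): \<open>c\<close> annihilates the multiples \<open>y\<^sup>m f\<close>. The theorem is thus
  a local Nullstellensatz; it is obtained here from spectral theory of commuting shift operators.

  Isolated implies bounded. Rescale so that the closed unit polydisc contains no further zero and
  all series converge absolutely there, and let \<open>V\<close> be the space of all bounded families, of finite
  or infinite support, that annihilate every \<open>y\<^sup>m f\<close>. The shifts \<open>S\<^sub>i\<close> act on \<open>V\<close> and commute. A
  common eigenvector has the form \<open>u\<^sub>j = u\<^sub>0 \<lambda>\<^sup>j\<close> (\<open>joint_eigenvector_eq_monomials\<close>), is
  bounded only if \<open>\<lambda>\<close> lies in the polydisc, and annihilates \<open>f\<close> only if \<open>f\<close> vanishes at \<open>\<lambda>\<close>; hence
  \<open>\<lambda> = 0\<close>. On nonzero shift-invariant spaces of this kind every shift has an eigenvalue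
  (\<open>eigenvalue_exists\<close>), so any eigenvector of \<open>S\<^sub>i\<close> leads to a common one with the same \<open>\<lambda>\<^sub>i\<close>,
  and so \<open>S\<^sub>i\<close> has no nonzero eigenvalue at all. The ball of \<open>V\<close> is compact for pointwise
  convergence, and translates of approximate eigenvectors converge to eigenvectors; so the absence
  of eigenvalues away from 0 forces the spectral radius of \<open>S\<^sub>i\<close> to be 0
  (\<open>power_bounded_if_no_eigenvalue\<close>), and some power of \<open>S\<^sub>i\<close> has norm at most a half. If now \<open>u \<in> V\<close>
  vanishes on the box of multi-indices below these exponents, each entry outside the box is an entry of
  such a power applied to \<open>u\<close>, so the norm of \<open>u\<close> is at most half of itself and \<open>u = 0\<close>
  (\<open>annihilator_determined_on_box\<close>). As every \<open>\<D>\<^sup>\<alpha>\<close> embeds into \<open>V\<close>, the size of the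
  box bounds all dimensions.

  Bounded implies isolated. If every \<open>\<D>\<^sup>n\<close> contained a functional of exact order \<open>n\<close>, the dimensions
  would be unbounded (\<open>dim_dual_space_gt\<close>). So for some \<open>n\<close> no functional in \<open>\<D>\<^sup>n\<close> has order \<open>n\<close>,
  and linear duality makes each monomial of degree \<open>n\<close> a combination of multiples of the
  \<open>f \<in> F\<close> up to terms of degree above \<open>n\<close> (\<open>monomial_in_span_truncated_multiples\<close>). At a common zero
  with largest coordinate \<open>t = \<bar>y\<^sub>i\<bar>\<close> the multiples vanish, which leaves \<open>t\<^sup>n \<le> C t\<^sup>n\<^sup>+\<^sup>1\<close> and
  hence \<open>t = 0\<close> or \<open>t \<ge> 1/C\<close>.
\<close>

section \<open>Taylor expansion of analytic functions\<close>

lemma square_times_power_bounded: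
  fixes q :: real
  assumes "0 \<le> q" "q < 1"
  obtains B where "\<And>n. real n ^ 2 * q ^ n \<le> B"
proof -
  have "norm (sqrt q) < 1" using assms by simp
  from powser_times_n_limit_0[OF this] have "Bseq (\<lambda>n. of_nat n * sqrt q ^ n)"
    by (intro convergent_imp_Bseq convergentI)
  then obtain C where C: "\<And>n. norm (real n * sqrt q ^ n) \<le> C" by (auto simp: Bseq_def)
  have "real n ^ 2 * q ^ n \<le> C ^ 2" for n
  proof -
    have "real n ^ 2 * q ^ n = (real n * sqrt q ^ n) ^ 2"
      using assms by (simp add: power_mult_distrib power_mult[symmetric] mult.commute[of n 2]) (simp add: power_mult)
    also have "\<dots> \<le> C ^ 2"
      using C[of n] assms by (intro power_mono) auto
    finally show ?thesis .
  qed
  with that show ?thesis by blast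
qed

text \<open>
  The index set is arbitrary and the exponents \<open>k j\<close> may repeat, so a multivariate series can be
  differentiated in one variable without first being regrouped into a series in that variable. The
  difference quotients differ from the formal derivative by \<open>O(\<bar>t\<bar>)\<close>, because
  \<open>k\<^sup>2 K\<^sup>k\<close> is dominated by \<open>R\<^sup>k\<close> for any \<open>K < R\<close>.
\<close>

lemma has_sum_termwise_derivative:
  fixes a :: "'j \<Rightarrow> complex" and k :: "'j \<Rightarrow> nat"
  assumes h: "\<And>z. cmod z < r \<Longrightarrow> ((\<lambda>j. a j * z ^ k j) has_sum h z) UNIV"
    and z: "cmod z < r"
  obtains D where "(h has_field_derivative D) (at z)"
    and "((\<lambda>j. a j * of_nat (k j) * z ^ (k j - 1)) has_sum D) UNIV"
proof -
  \<comment> \<open>The gap between \<open>K\<close> and \<open>R\<close> absorbs the factors \<open>k\<close> and \<open>k - 1\<close> that differentiation produces.\<close>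
  obtain R where R: "cmod z < R" "R < r" using z dense by blast
  obtain K where K: "cmod z < K" "K < R" using R dense by blast
  have K0: "K > 0" using K(1) norm_ge_zero[of z] by linarith
  have R0: "R > 0" using K K0 by simp
  have "(\<lambda>j. a j * of_real R ^ k j) summable_on UNIV"
    using h[of "of_real R"] R R0 by (auto simp: summable_on_def)
  then have s: "(\<lambda>j. cmod (a j) * R ^ k j) summable_on UNIV"
    using R0 by (simp add: summable_on_iff_abs_summable_on_complex norm_mult norm_power)
  obtain B where B: "\<And>n. real n ^ 2 * (K / R) ^ n \<le> B"
    using square_times_power_bounded[of "K / R"] K K0 by auto
  have B': "real n ^ 2 * K ^ n \<le> B * R ^ n" for n
    using B[of n] R0 by (simp add: power_divide field_simps)
  have bound1: "real n * K ^ (n - 1) \<le> B / K * R ^ n" for n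
  proof (cases n)
    case (Suc m)
    have "real n * K ^ (n - 1) * K \<le> real n ^ 2 * K ^ n"
      using K0 Suc by (simp add: power2_eq_square mult_right_mono)
    also have "\<dots> \<le> B * R ^ n" by (rule B')
    finally show ?thesis using K0 by (simp add: field_simps)
  qed (use B'[of 0] K0 R0 in simp)
  have bound2: "real n * real (n - 1) * K ^ (n - 2) \<le> B / K ^ 2 * R ^ n" for n
  proof (cases "n \<ge> 2")
    case True
    have "real n * real (n - 1) * K ^ (n - 2) * K ^ 2 \<le> real n * real n * K ^ (n - 2) * K ^ 2"
      using K0 by (intro mult_right_mono mult_left_mono) auto
    also have "\<dots> = real n ^ 2 * K ^ n"
      using True by (simp add: power2_eq_square power_add[symmetric] mult.assoc)
        (metis le_add_diff_inverse2 mult.assoc power2_eq_square power_add)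
    also have "\<dots> \<le> B * R ^ n" by (rule B')
    finally show ?thesis using K0 by (simp add: field_simps)
  next
    case False
    then have "n = 0 \<or> n = 1" by auto
    then show ?thesis using B'[of 0] K0 R0 by auto
  qed
  define S where "S = (\<Sum>\<^sub>\<infinity>j. cmod (a j) * R ^ k j)"
  have S: "((\<lambda>j. cmod (a j) * R ^ k j) has_sum S) UNIV" unfolding S_def by (rule has_sum_infsum[OF s])
  let ?d = "\<lambda>j. a j * of_nat (k j) * z ^ (k j - 1)"
  have "?d summable_on UNIV"
  proof (rule abs_summable_summable, rule Infinite_Sum.abs_summable_on_comparison_test)
    show "(\<lambda>j. norm (B / K * (cmod (a j) * R ^ k j))) summable_on UNIV"
      using summable_on_cmult_right[OF s, of "\<bar>B / K\<bar>"] R0 by (simp add: abs_mult)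
    fix j
    have "norm (?d j) = cmod (a j) * (real (k j) * cmod z ^ (k j - 1))"
      by (simp add: norm_mult norm_power)
    also have "\<dots> \<le> cmod (a j) * (real (k j) * K ^ (k j - 1))"
      using K by (intro mult_left_mono power_mono) auto
    also have "\<dots> \<le> cmod (a j) * (B / K * R ^ k j)"
      by (intro mult_left_mono bound1) auto
    also have "\<dots> = B / K * (cmod (a j) * R ^ k j)" by simp
    also have "\<dots> \<le> norm (B / K * (cmod (a j) * R ^ k j))" by (simp only: real_norm_def abs_ge_self)
    finally show "norm (?d j) \<le> norm (B / K * (cmod (a j) * R ^ k j))" .
  qed
  then obtain D where D: "(?d has_sum D) UNIV" by (auto simp: summable_on_def)
  have "((\<lambda>t. (h (z + t) - h z) / t - D) \<longlongrightarrow> 0) (at 0)"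
  proof (rule Lim_null_comparison)
    show "((\<lambda>t. B / K ^ 2 * S * cmod t) \<longlongrightarrow> 0) (at 0)"
      using K0 by (auto intro!: tendsto_eq_intros)
    show "\<forall>\<^sub>F t in at 0. norm ((h (z + t) - h z) / t - D) \<le> B / K ^ 2 * S * cmod t"
      unfolding eventually_at
    proof (intro exI[of _ "K - cmod z"] conjI ballI impI)
      fix t :: complex assume "t \<noteq> 0 \<and> dist t 0 < K - cmod z"
      then have t: "t \<noteq> 0" "cmod (z + t) \<le> K"
        using norm_triangle_ineq[of z t] by auto
      let ?q = "\<lambda>j. ((z + t) ^ k j - z ^ k j) / t - of_nat (k j) * z ^ (k j - 1)"
      have "((\<lambda>j. (a j * (z + t) ^ k j + - (a j * z ^ k j)) * (1 / t) + - ?d j) has_sum ((h (z + t) + - h z) * (1 / t) + - D)) UNIV"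
        using t K R by (intro has_sum_add has_sum_uminusI has_sum_cmult_left h D) auto
      also have "(\<lambda>j. (a j * (z + t) ^ k j + - (a j * z ^ k j)) * (1 / t) + - ?d j) = (\<lambda>j. a j * ?q j)"
        by (simp add: fun_eq_iff algebra_simps diff_divide_distrib)
      finally have sum: "((\<lambda>j. a j * ?q j) has_sum ((h (z + t) - h z) / t - D)) UNIV" by simp
      have S': "((\<lambda>j. (B / K ^ 2 * cmod t) * (cmod (a j) * R ^ k j)) has_sum (B / K ^ 2 * cmod t) * S) UNIV"
        by (rule has_sum_cmult_right[OF S])
      have "norm ((h (z + t) - h z) / t - D) \<le> (B / K ^ 2 * cmod t) * S"
      proof (rule norm_infsum_le[OF sum S'])
        fix j
        have "norm (?q j) \<le> of_nat (k j) * of_nat (k j - Suc 0) * K ^ (k j - 2) * norm t"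
          using lemma_termdiff3[OF t(1) _ t(2), of "k j"] K by simp
        also have "\<dots> \<le> B / K ^ 2 * R ^ k j * norm t"
          using bound2[of "k j"] by (intro mult_right_mono) auto
        finally have "cmod (a j) * norm (?q j) \<le> cmod (a j) * (B / K ^ 2 * R ^ k j * norm t)"
          by (rule mult_left_mono) simp
        then show "norm (a j * ?q j) \<le> (B / K ^ 2 * cmod t) * (cmod (a j) * R ^ k j)"
          by (simp add: norm_mult mult_ac)
      qed
      then show "norm ((h (z + t) - h z) / t - D) \<le> B / K ^ 2 * S * cmod t" by (simp add: mult_ac)
    qed (use K in auto)
  qed
  then have "(h has_field_derivative D) (at z)"
    unfolding DERIV_def by (rule LIM_zero_cancel)
  with D that show ?thesis by blast
qed

definition has_power_series where
  "has_power_series f c x r \<longleftrightarrow>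
    (\<forall>y. (\<forall>i. cmod (y $ i - x $ i) < r) \<longrightarrow>
      ((\<lambda>j. c j * (\<Prod>i\<in>UNIV. (y $ i - x $ i) ^ j i)) has_sum f y) UNIV)"
  for f :: "complex ^ 's::finite \<Rightarrow> complex"

lemma has_power_series_partial_deriv:
  fixes f :: "complex ^ 's::finite \<Rightarrow> complex"
  assumes f: "has_power_series f c x r"
  shows "has_power_series (partial_deriv i f) (\<lambda>j. of_nat (Suc (j i)) * c (j(i := Suc (j i)))) x r"
  unfolding has_power_series_def
proof (intro allI impI)
  fix y :: "complex ^ 's" assume y: "\<forall>i. cmod (y $ i - x $ i) < r"
  let ?P = "\<lambda>j. \<Prod>k\<in>UNIV - {i}. (y $ k - x $ k) ^ j k"
  let ?h = "\<lambda>z. f (\<chi> k. if k = i then x $ i + z else y $ k)"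
  have "((\<lambda>j. c j * ?P j * z ^ j i) has_sum ?h z) UNIV" if "cmod z < r" for z
  proof -
    let ?y = "\<chi> k. if k = i then x $ i + z else y $ k"
    have "((\<lambda>j. c j * (\<Prod>k\<in>UNIV. (?y $ k - x $ k) ^ j k)) has_sum ?h z) UNIV"
      by (rule f[unfolded has_power_series_def, rule_format]) (use y that in simp)
    moreover have "(\<Prod>k\<in>UNIV. (?y $ k - x $ k) ^ j k) = ?P j * z ^ j i" for j
      by (subst prod.remove[of UNIV i]) (auto intro!: prod.cong)
    ultimately show ?thesis by (simp add: mult.assoc)
  qed
  then obtain D where D: "(?h has_field_derivative D) (at (y $ i - x $ i))"
    and sum: "((\<lambda>j. c j * ?P j * of_nat (j i) * (y $ i - x $ i) ^ (j i - 1)) has_sum D) UNIV"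
    by (rule has_sum_termwise_derivative[where k = "\<lambda>j. j i"]) (use y in auto)
  have "((\<lambda>z. z - x $ i) has_field_derivative 1) (at (y $ i))"
    by (auto intro!: derivative_eq_intros)
  from DERIV_chain2[where f = ?h and g = "\<lambda>z. z - x $ i", OF D this]
  have "((\<lambda>z. ?h (z - x $ i)) has_field_derivative D) (at (y $ i))" by simp
  then have pd: "partial_deriv i f y = D"
    unfolding partial_deriv_def by (intro DERIV_imp_deriv) (simp cong: if_cong)
  let ?up = "\<lambda>j::'s \<Rightarrow> nat. j(i := Suc (j i))"
  have inj: "inj ?up" by (rule inj_on_inverseI[of _ "\<lambda>j. j(i := j i - 1)"]) simp
  have range: "j \<in> range ?up" if "j i \<noteq> 0" for j
    using that by (intro image_eqI[of _ _ "j(i := j i - 1)"]) auto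
  have "((\<lambda>j. c j * ?P j * of_nat (j i) * (y $ i - x $ i) ^ (j i - 1)) has_sum D) (range ?up)"
    using sum by (rule has_sum_cong_neutral[THEN iffD1, rotated -1]) (use range in auto)
  then have sum': "((\<lambda>j. c (?up j) * ?P (?up j) * of_nat (Suc (j i)) * (y $ i - x $ i) ^ j i) has_sum D) UNIV"
    by (subst (asm) has_sum_reindex[OF inj]) (simp add: o_def)
  have eq: "c (?up j) * ?P (?up j) * of_nat (Suc (j i)) * (y $ i - x $ i) ^ j i =
      of_nat (Suc (j i)) * c (?up j) * (\<Prod>k\<in>UNIV. (y $ k - x $ k) ^ j k)" for j
  proof -
    have "?P (?up j) = ?P j" by (intro prod.cong) auto
    moreover have "(\<Prod>k\<in>UNIV. (y $ k - x $ k) ^ j k) = (y $ i - x $ i) ^ j i * ?P j"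
      by (rule prod.remove) auto
    ultimately show ?thesis by simp
  qed
  show "((\<lambda>j. of_nat (Suc (j i)) * c (?up j) * (\<Prod>i\<in>UNIV. (y $ i - x $ i) ^ j i))
      has_sum partial_deriv i f y) UNIV"
    using sum' unfolding pd eq .
qed

lemma has_power_series_funpow_partial_deriv:
  assumes f: "has_power_series f c x r"
  shows "has_power_series ((partial_deriv i ^^ n) f) (\<lambda>j. fact (j i + n) / fact (j i) * c (j(i := j i + n))) x r"
proof (induction n)
  case (Suc n)
  have "of_nat (Suc (j i)) * (fact ((j(i := Suc (j i))) i + n) / fact ((j(i := Suc (j i))) i) *
      c ((j(i := Suc (j i)))(i := (j(i := Suc (j i))) i + n))) =
      fact (j i + Suc n) / fact (j i) * c (j(i := j i + Suc n))" for j
    using of_nat_neq_0[of "j i"] by (simp add: fact_Suc[of "j i"] del: of_nat_Suc fact_Suc)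
  with has_power_series_partial_deriv[OF Suc, of i] show ?case by (simp only: funpow.simps o_apply)
qed (use f in simp)

text \<open>
  The variables in \<open>is\<close> have been differentiated already, the others not yet; \<open>distinct\<close> keeps each
  index shift from being applied twice.
\<close>

lemma has_power_series_mixed_partials:
  assumes f: "has_power_series f c x r" and "distinct is"
  shows "has_power_series (foldr (\<lambda>i. partial_deriv i ^^ m i) is f)
    (\<lambda>j. (\<Prod>i\<in>set is. fact (j i + m i) / fact (j i)) * c (\<lambda>i. if i \<in> set is then j i + m i else j i)) x r"
  using \<open>distinct is\<close>
proof (induction "is")
  case (Cons a as)
  have "fact (j a + m a) / fact (j a) *
      ((\<Prod>i\<in>set as. fact ((j(a := j a + m a)) i + m i) / fact ((j(a := j a + m a)) i)) *
        c (\<lambda>i. if i \<in> set as then (j(a := j a + m a)) i + m i else (j(a := j a + m a)) i)) =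
      (\<Prod>i\<in>set (a # as). fact (j i + m i) / fact (j i)) *
        c (\<lambda>i. if i \<in> set (a # as) then j i + m i else j i)" for j
  proof -
    have "(\<Prod>i\<in>set as. fact ((j(a := j a + m a)) i + m i) / fact ((j(a := j a + m a)) i)) =
        (\<Prod>i\<in>set as. fact (j i + m i) / fact (j i) :: complex)"
      using Cons.prems by (intro prod.cong) auto
    moreover have "(\<lambda>i. if i \<in> set as then (j(a := j a + m a)) i + m i else (j(a := j a + m a)) i) =
        (\<lambda>i. if i \<in> set (a # as) then j i + m i else j i)"
      using Cons.prems by auto
    ultimately show ?thesis using Cons.prems by simp
  qed
  with has_power_series_funpow_partial_deriv[OF Cons.IH, where i = a and n = "m a"] Cons.prems
  show ?case by (simp add: mult.assoc)
qed (use f in simp)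

lemma has_power_series_center:
  assumes "has_power_series f c x r" "r > 0"
  shows "f x = c (\<lambda>_. 0)"
proof -
  let ?t = "\<lambda>j. c j * (\<Prod>i\<in>UNIV. (x $ i - x $ i) ^ j i)"
  have "(?t has_sum f x) UNIV"
    by (rule assms(1)[unfolded has_power_series_def, rule_format]) (use assms(2) in simp)
  moreover have "?t j = 0" if "j \<noteq> (\<lambda>_. 0)" for j
    using that by (auto simp: fun_eq_iff)
  ultimately have "(?t has_sum f x) {\<lambda>_. 0}"
    by (subst has_sum_cong_neutral[of UNIV _ ?t ?t]) auto
  then show ?thesis using has_sum_finite[of "{\<lambda>_. 0}" ?t] has_sum_unique by fastforce
qed

text \<open>
  The factorials accumulated by repeated differentiation cancel those in \<^term>\<open>diff_op\<close>. In
  particular the coefficients of a power series expansion are unique.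
\<close>

lemma diff_op_eq_coefficient:
  assumes "has_power_series f c x r" "r > 0"
  shows "diff_op m x f = c m"
proof -
  have "mixed_partial m f x = (\<Prod>i\<in>UNIV. fact (m i)) * c m"
    using has_power_series_center[OF has_power_series_mixed_partials[OF assms(1), of "sorted_list_of_set UNIV" m] assms(2)]
    by (simp add: mixed_partial_def)
  then show ?thesis by (simp add: diff_op_def)
qed

lemma polydisc_in_open:
  fixes S :: "(complex ^ 's::finite) set"
  assumes "open S" "x \<in> S"
  obtains r where "r > 0" "\<And>y. (\<And>i. cmod (y $ i - x $ i) < r) \<Longrightarrow> y \<in> S"
proof -
  from assms obtain e where e: "e > 0" "ball x e \<subseteq> S" by (rule openE)
  have "y \<in> S" if y: "\<And>i. cmod (y $ i - x $ i) < e / (2 * CARD('s))" for y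
  proof -
    have "dist y x \<le> (\<Sum>i\<in>UNIV. cmod ((y - x) $ i))"
      unfolding dist_norm norm_vec_def by (rule L2_set_le_sum) simp
    also have "\<dots> \<le> (\<Sum>i\<in>(UNIV::'s set). e / (2 * CARD('s)))"
      using y by (intro sum_mono) (auto intro: less_imp_le)
    also have "\<dots> < e" using e by simp
    finally show ?thesis using e by (auto simp: dist_commute)
  qed
  with e show ?thesis by (intro that[of "e / (2 * CARD('s))"]) auto
qed

lemma taylor_expansion:
  assumes f: "f mv_analytic_on \<Omega>" and x: "x \<in> \<Omega>"
  obtains r where "r > 0" "has_power_series f (\<lambda>j. diff_op j x f) x r"
proof -
  from f x obtain c where "\<forall>\<^sub>F y in nhds x. ((\<lambda>j. c j * (\<Prod>i\<in>UNIV. (y $ i - x $ i) ^ j i)) has_sum f y) UNIV"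
    unfolding mv_analytic_on_def by blast
  then obtain S where S: "open S" "x \<in> S" and
    sum: "\<And>y. y \<in> S \<Longrightarrow> ((\<lambda>j. c j * (\<Prod>i\<in>UNIV. (y $ i - x $ i) ^ j i)) has_sum f y) UNIV"
    unfolding eventually_nhds by blast
  obtain r where r: "r > 0" "\<And>y. (\<And>i. cmod (y $ i - x $ i) < r) \<Longrightarrow> y \<in> S"
    using polydisc_in_open[OF S] by blast
  have c: "has_power_series f c x r" unfolding has_power_series_def using r sum by blast
  have "c = (\<lambda>j. diff_op j x f)" using diff_op_eq_coefficient[OF c r(1)] by auto
  with c r that show ?thesis by metis
qed

abbreviation order_of :: "('s::finite \<Rightarrow> nat) \<Rightarrow> nat" where
  "order_of j \<equiv> \<Sum>i\<in>UNIV. j i"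

definition taylor_coeff :: "complex ^ 's::{finite,linorder} \<Rightarrow> (complex ^ 's::{finite,linorder} \<Rightarrow> complex) \<Rightarrow> 's multiindex \<Rightarrow> complex" where
  "taylor_coeff x f = (\<lambda>j. diff_op j x f)"

lemma finite_order_le: "finite {j :: 's::finite \<Rightarrow> nat. order_of j \<le> n}"
proof (rule finite_subset)
  have "j i \<le> order_of j" for j :: "'s \<Rightarrow> nat" and i by (rule member_le_sum) auto
  then show "{j :: 's \<Rightarrow> nat. order_of j \<le> n} \<subseteq> PiE UNIV (\<lambda>_. {..n})"
    by (fastforce intro: order_trans)
  show "finite (PiE (UNIV :: 's set) (\<lambda>_. {..n}))" by (rule finite_PiE) auto
qed

lemma order_of_upd: "order_of (j(i := Suc (j i))) = Suc (order_of j)" for j :: "'s::finite \<Rightarrow> nat"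
proof -
  have "order_of (j(i := Suc (j i))) = Suc (j i) + (\<Sum>k\<in>UNIV - {i}. j k)"
    by (subst sum.remove[of UNIV i]) auto
  moreover have "order_of j = j i + (\<Sum>k\<in>UNIV - {i}. j k)" by (rule sum.remove) auto
  ultimately show ?thesis by simp
qed

lemma order_of_add: "order_of (\<lambda>i. j i + m i) = order_of j + order_of m"
  by (rule sum.distrib)

lemma has_power_series_mono:
  assumes "has_power_series f c x r" "r' \<le> r"
  shows "has_power_series f c x r'"
  unfolding has_power_series_def
proof (intro allI impI)
  fix y assume "\<forall>i. cmod (y $ i - x $ i) < r'"
  then have "\<forall>i. cmod (y $ i - x $ i) < r" using assms(2) by (auto intro: less_le_trans)
  with assms(1) show "((\<lambda>j. c j * (\<Prod>i\<in>UNIV. (y $ i - x $ i) ^ j i)) has_sum f y) UNIV"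
    unfolding has_power_series_def by blast
qed

lemma common_taylor_expansion:
  fixes F :: "(complex ^ 's::{finite,linorder} \<Rightarrow> complex) set"
  assumes "finite F" "\<And>f. f \<in> F \<Longrightarrow> f mv_analytic_on \<Omega>" "x \<in> \<Omega>"
  obtains r where "r > 0" "\<And>f. f \<in> F \<Longrightarrow> has_power_series f (taylor_coeff x f) x r"
proof -
  have "\<exists>r>0. \<forall>f\<in>F. has_power_series f (taylor_coeff x f) x r"
    using assms(1,2)
  proof (induction F rule: finite_induct)
    case (insert f F)
    then obtain r where r: "r > 0" "\<And>g. g \<in> F \<Longrightarrow> has_power_series g (taylor_coeff x g) x r" by auto
    obtain r' where "r' > 0" "has_power_series f (taylor_coeff x f) x r'"
      unfolding taylor_coeff_def by (rule taylor_expansion[OF insert.prems[of f] assms(3)]) auto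
    with r show ?case
      by (intro exI[of _ "min r r'"]) (auto intro: has_power_series_mono[OF _ min.cobounded1] has_power_series_mono[OF _ min.cobounded2])
  qed (auto intro: exI[of _ 1])
  with that show ?thesis by blast
qed

lemma prod_power_const: "(\<Prod>i\<in>UNIV. a ^ j i) = a ^ order_of j" for a :: "'a::comm_semiring_1"
  by (simp add: power_sum)

lemma norm_taylor_summable:
  fixes x :: "complex ^ 's::{finite,linorder}"
  assumes f: "has_power_series f (taylor_coeff x f) x r" and \<rho>: "0 < \<rho>" "\<rho> < r"
  shows "(\<lambda>j. cmod (taylor_coeff x f j) * \<rho> ^ order_of j) summable_on UNIV"
proof -
  let ?y = "x + (\<chi> i. of_real \<rho>)"
  have "((\<lambda>j. taylor_coeff x f j * (\<Prod>i\<in>UNIV. (?y $ i - x $ i) ^ j i)) has_sum f ?y) UNIV"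
    by (rule f[unfolded has_power_series_def, rule_format]) (use \<rho> in simp)
  then have "(\<lambda>j. taylor_coeff x f j * of_real \<rho> ^ order_of j) summable_on UNIV"
    by (auto simp: summable_on_def prod_power_const)
  then show ?thesis
    using \<rho> by (simp add: summable_on_iff_abs_summable_on_complex norm_mult norm_power)
qed

section \<open>Shift-invariant spaces of bounded families\<close>

definition shift :: "'s \<Rightarrow> nat \<Rightarrow> (('s \<Rightarrow> nat) \<Rightarrow> complex) \<Rightarrow> ('s \<Rightarrow> nat) \<Rightarrow> complex" where
  "shift i k u = (\<lambda>j. u (j(i := j i + k)))"

definition sup_norm :: "(('s \<Rightarrow> nat) \<Rightarrow> complex) \<Rightarrow> real" where
  "sup_norm u = (SUP j. cmod (u j))"

definition bdd_family :: "(('s \<Rightarrow> nat) \<Rightarrow> complex) \<Rightarrow> bool" where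
  "bdd_family u \<longleftrightarrow> bdd_above (range (\<lambda>j. cmod (u j)))"

lemma bdd_familyI: "(\<And>j. cmod (u j) \<le> K) \<Longrightarrow> bdd_family u"
  unfolding bdd_family_def by (auto intro!: bdd_aboveI)

lemma cmod_le_sup_norm: "bdd_family u \<Longrightarrow> cmod (u j) \<le> sup_norm u"
  unfolding sup_norm_def bdd_family_def by (rule cSUP_upper) auto

lemma sup_norm_le: "(\<And>j. cmod (u j) \<le> K) \<Longrightarrow> sup_norm u \<le> K"
  unfolding sup_norm_def by (rule cSUP_least) auto

lemma sup_norm_nonneg: "bdd_family u \<Longrightarrow> 0 \<le> sup_norm u"
  by (rule order_trans[OF norm_ge_zero cmod_le_sup_norm])

lemma sup_norm_eq_0: "bdd_family u \<Longrightarrow> sup_norm u \<le> 0 \<Longrightarrow> u = (\<lambda>_. 0)"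
  using cmod_le_sup_norm[of u] by (auto simp: fun_eq_iff) (metis norm_le_zero_iff order_trans)

lemma shift_shift: "shift i k (shift i l u) = shift i (k + l) u"
  by (auto simp: shift_def fun_eq_iff add.assoc)

lemma shift_0 [simp]: "shift i 0 u = u"
  by (simp add: shift_def)

lemma bdd_family_shift: "bdd_family u \<Longrightarrow> bdd_family (shift i k u)"
  by (rule bdd_familyI[of _ "sup_norm u"]) (simp add: shift_def cmod_le_sup_norm)

lemma sup_norm_shift_le: "bdd_family u \<Longrightarrow> sup_norm (shift i k u) \<le> sup_norm u"
  by (rule sup_norm_le) (simp add: shift_def cmod_le_sup_norm)

text \<open>
  The last axiom says that the unit ball is closed under pointwise limits. It makes the ball compact
  for pointwise convergence, which takes the place of finite dimension, and it passes to eigenspaces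
  of the shifts.
\<close>

locale shift_space =
  fixes V :: "(('s::finite \<Rightarrow> nat) \<Rightarrow> complex) set"
  assumes bdd: "u \<in> V \<Longrightarrow> bdd_family u"
    and zero: "(\<lambda>_. 0) \<in> V"
    and add: "u \<in> V \<Longrightarrow> v \<in> V \<Longrightarrow> (\<lambda>j. u j + v j) \<in> V"
    and scale: "u \<in> V \<Longrightarrow> (\<lambda>j. a * u j) \<in> V"
    and shift_once: "u \<in> V \<Longrightarrow> shift i 1 u \<in> V"
    and limit: "(\<And>n::nat. U n \<in> V) \<Longrightarrow> (\<And>n j. cmod (U n j) \<le> 1) \<Longrightarrow>
      (\<And>j. (\<lambda>n. U n j) \<longlonglongrightarrow> u j) \<Longrightarrow> u \<in> V"
begin

lemma diff: "u \<in> V \<Longrightarrow> v \<in> V \<Longrightarrow> (\<lambda>j. u j - v j) \<in> V"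
  using add[of u "\<lambda>j. -1 * v j"] scale[of v "-1"] by simp

lemma sum: "finite A \<Longrightarrow> (\<And>a. a \<in> A \<Longrightarrow> U a \<in> V) \<Longrightarrow> (\<lambda>j. \<Sum>a\<in>A. U a j) \<in> V"
  by (induction A rule: finite_induct) (auto intro: zero add)

lemma shift: "u \<in> V \<Longrightarrow> shift i k u \<in> V"
proof (induction k)
  case (Suc k)
  then show ?case using shift_once[of "shift i k u" i] by (simp add: shift_shift)
qed simp

lemma translate: assumes "u \<in> V" shows "(\<lambda>j. u (\<lambda>i. j i + m i)) \<in> V"
proof -
  have "(\<lambda>j. u (\<lambda>i. if i \<in> A then j i + m i else j i)) \<in> V" if "finite A" for A :: "'s set"
    using that
  proof (induction A rule: finite_induct)
    case (insert a A)
    let ?w = "\<lambda>j. u (\<lambda>i. if i \<in> A then j i + m i else j i)"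
    have "shift a (m a) ?w = (\<lambda>j. u (\<lambda>i. if i \<in> insert a A then j i + m i else j i))"
      using insert.hyps by (auto simp: shift_def fun_eq_iff intro!: arg_cong[of _ _ u])
    then show ?case using shift[OF insert.IH, of a "m a"] by simp
  qed (use assms in simp)
  from this[of UNIV] show ?thesis by simp
qed

end

lemma bounded_families_convergent_subsequence:
  fixes U :: "nat \<Rightarrow> ('b::countable \<Rightarrow> complex)"
  assumes "\<And>n j. cmod (U n j) \<le> 1"
  obtains u r where "strict_mono r" "\<And>j. (\<lambda>n. U (r n) j) \<longlonglongrightarrow> u j"
proof -
  have "compactin (product_topology (\<lambda>_::'b. euclidean :: complex topology) UNIV) (PiE UNIV (\<lambda>_. cball 0 1))"
    by (subst compactin_PiE) (auto simp: compactin_euclidean_iff)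
  hence "compact (PiE UNIV (\<lambda>_::'b. cball (0::complex) 1))"
    by (simp add: euclidean_product_topology compactin_euclidean_iff)
  hence "seq_compact (PiE UNIV (\<lambda>_::'b. cball (0::complex) 1))"
    by (rule compact_imp_seq_compact)
  moreover have "\<forall>n. U n \<in> PiE UNIV (\<lambda>_::'b. cball (0::complex) 1)"
    using assms by (auto simp: PiE_def)
  ultimately obtain u r where r: "strict_mono (r::nat\<Rightarrow>nat)" and lim: "(U \<circ> r) \<longlonglongrightarrow> u"
    unfolding seq_compact_def by metis
  have "(\<lambda>n. U (r n) j) \<longlonglongrightarrow> u j" for j
  proof -
    have "continuous_on UNIV (\<lambda>x::'b \<Rightarrow> complex. x j)" by (rule continuous_on_product_coordinates)
    hence "isCont (\<lambda>x::'b \<Rightarrow> complex. x j) u" by (rule continuous_on_interior) simp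
    from isCont_tendsto_compose[OF this lim] show ?thesis by (simp add: o_def)
  qed
  with r that show ?thesis by blast
qed

text \<open>
  Approximate eigenvectors converge to eigenvectors. A pointwise limit of vectors of norm 1 may
  vanish; shift invariance prevents this, since translating the vector moves an almost
  maximal entry to the origin, where it survives in the limit.
\<close>

lemma (in shift_space) shift_minus_eigenvalue_bounded_below:
  assumes K: "compact K"
    and no_eig: "\<And>l u. l \<in> K \<Longrightarrow> u \<in> V \<Longrightarrow> shift i 1 u = (\<lambda>j. l * u j) \<Longrightarrow> u = (\<lambda>_. 0)"
  obtains d where "d > 0" "\<And>l u. l \<in> K \<Longrightarrow> u \<in> V \<Longrightarrow>
      d * sup_norm u \<le> sup_norm (\<lambda>j. shift i 1 u j - l * u j)"
proof (rule ccontr)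
  assume "\<not> thesis"
  with that have *: "\<exists>l u. l \<in> K \<and> u \<in> V \<and> sup_norm (\<lambda>j. shift i 1 u j - l * u j) < d * sup_norm u" if "d > 0" for d
    using \<open>d > 0\<close> by (meson not_le)
  have "\<exists>l w. l \<in> K \<and> w \<in> V \<and> (\<forall>j. cmod (w j) \<le> 1) \<and> cmod (w (\<lambda>_. 0)) \<ge> 1/2 \<and>
      (\<forall>j. cmod (shift i 1 w j - l * w j) \<le> 1 / Suc n)" for n
  proof -
    obtain l u where l: "l \<in> K" and u: "u \<in> V"
      and less: "sup_norm (\<lambda>j. shift i 1 u j - l * u j) < 1 / Suc n * sup_norm u"
      using *[of "1 / Suc n"] by auto
    let ?N = "sup_norm u"
    have bu: "bdd_family u" using bdd u .
    have diffV: "(\<lambda>j. shift i 1 u j - l * u j) \<in> V" by (intro diff scale shift u)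
    have "0 \<le> sup_norm (\<lambda>j. shift i 1 u j - l * u j)" by (intro sup_norm_nonneg bdd diffV)
    with less have "0 < 1 / Suc n * ?N" by linarith
    hence N: "?N > 0" by (simp add: zero_less_divide_iff)
    \<comment> \<open>Translating by \<open>m\<close> brings the large entry to the origin.\<close>
    have "\<exists>m. ?N / 2 < cmod (u m)"
      by (rule ccontr) (use sup_norm_le[of u "?N/2"] N in \<open>auto simp: not_less\<close>)
    then obtain m where m: "?N / 2 < cmod (u m)" by blast
    define w where "w = (\<lambda>j. (1 / ?N) * u (\<lambda>i. j i + m i))"
    have "w \<in> V" unfolding w_def by (intro scale translate u)
    moreover have "cmod (w j) \<le> 1" for j
      using N cmod_le_sup_norm[OF bu, of "\<lambda>i. j i + m i"] by (simp add: w_def norm_divide)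
    moreover have "cmod (w (\<lambda>_. 0)) \<ge> 1/2"
      using N m by (simp add: w_def norm_divide field_simps)
    moreover have "cmod (shift i 1 w j - l * w j) \<le> 1 / Suc n" for j
    proof -
      let ?j = "\<lambda>i. j i + m i"
      have e: "(\<lambda>a. (j(i := j i + 1)) a + m a) = ?j(i := ?j i + 1)" by auto
      have "shift i 1 w j - l * w j = (1 / ?N) * (shift i 1 u ?j - l * u ?j)"
        unfolding w_def shift_def e by (simp add: algebra_simps)
      also have "cmod \<dots> = (1 / ?N) * cmod (shift i 1 u ?j - l * u ?j)"
        using N by (simp add: norm_divide)
      also have "\<dots> \<le> (1 / ?N) * (1 / Suc n * ?N)"
        using N cmod_le_sup_norm[OF bdd[OF diffV], of ?j] less by (intro mult_left_mono) auto
      finally show ?thesis using N by simp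
    qed
    ultimately show ?thesis using l by blast
  qed
  then obtain L W where L: "\<And>n. L n \<in> K" and W: "\<And>n. W n \<in> V" "\<And>n j. cmod (W n j) \<le> 1"
    "\<And>n. cmod (W n (\<lambda>_. 0)) \<ge> 1/2"
    and small: "\<And>n j. cmod (shift i 1 (W n) j - L n * W n j) \<le> 1 / Suc n"
    by metis
  obtain l r where l: "l \<in> K" and r: "strict_mono r" and Ll: "(L \<circ> r) \<longlonglongrightarrow> l"
    using K L unfolding compact_def by metis
  obtain w q where q: "strict_mono q" and Ww: "\<And>j. (\<lambda>n. W (r (q n)) j) \<longlonglongrightarrow> w j"
    using bounded_families_convergent_subsequence[of "\<lambda>n. W (r n)"] W(2) by metis
  have w: "w \<in> V" by (rule limit[OF _ _ Ww]) (use W in auto)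
  have Lq: "(\<lambda>n. L (r (q n))) \<longlonglongrightarrow> l" using LIMSEQ_subseq_LIMSEQ[OF Ll q] by (simp add: o_def)
  have "shift i 1 w j - l * w j = 0" for j
  proof (rule tendsto_norm_zero_cancel[THEN LIMSEQ_unique[rotated]])
    show "(\<lambda>n. shift i 1 (W (r (q n))) j - L (r (q n)) * W (r (q n)) j) \<longlonglongrightarrow> shift i 1 w j - l * w j"
      unfolding shift_def by (intro tendsto_intros Ww Lq)
    have "(\<lambda>n. 1 / real (Suc n)) \<longlonglongrightarrow> 0" by (rule LIMSEQ_Suc[OF lim_1_over_n])
    from LIMSEQ_subseq_LIMSEQ[OF this strict_mono_o[OF r q]]
    show "(\<lambda>n. cmod (shift i 1 (W (r (q n))) j - L (r (q n)) * W (r (q n)) j)) \<longlonglongrightarrow> 0"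
      by (rule Lim_null_comparison[rotated]) (use small in \<open>auto simp: o_def\<close>)
  qed
  hence "w = (\<lambda>_. 0)" using no_eig[OF l w] by (auto simp: fun_eq_iff)
  moreover have "cmod (w (\<lambda>_. 0)) \<ge> 1/2"
    by (rule LIMSEQ_le_const[OF tendsto_norm[OF Ww]]) (use W(3) in auto)
  ultimately show False by simp
qed

section \<open>The spectral radius of a shift\<close>

text \<open>
  For \<open>a = 1/l\<close> this is a partial sum of the Neumann series of the resolvent at \<open>l\<close>.
\<close>

definition geometric :: "'s \<Rightarrow> complex \<Rightarrow> nat \<Rightarrow> (('s \<Rightarrow> nat) \<Rightarrow> complex) \<Rightarrow> ('s \<Rightarrow> nat) \<Rightarrow> complex" where
  "geometric i a n u = (\<lambda>j. \<Sum>k<n. a ^ k * shift i k u j)"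

lemma geometric_shift: "geometric i a n (shift i m u) = shift i m (geometric i a n u)"
  by (simp add: geometric_def shift_def add_ac fun_eq_iff)

lemma shift_minus_eigenvalue_geometric:
  assumes "l \<noteq> 0"
  shows "shift i 1 (geometric i (1 / l) n u) j - l * geometric i (1 / l) n u j =
    - l * (u j - (1 / l) ^ n * shift i n u j)"
proof (induction n)
  case (Suc n)
  have g: "geometric i (1 / l) (Suc n) u = (\<lambda>j. geometric i (1 / l) n u j + (1 / l) ^ n * shift i n u j)"
    by (simp add: geometric_def)
  have "shift i 1 (geometric i (1 / l) (Suc n) u) j - l * geometric i (1 / l) (Suc n) u j =
     (shift i 1 (geometric i (1 / l) n u) j - l * geometric i (1 / l) n u j)
       + ((1 / l) ^ n * shift i (Suc n) u j - l * (1 / l) ^ n * shift i n u j)"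
    unfolding g by (simp add: shift_def algebra_simps)
  also have "\<dots> = - l * (u j - (1 / l) ^ Suc n * shift i (Suc n) u j)"
    unfolding Suc.IH using assms by (simp add: algebra_simps)
  finally show ?case .
qed (simp add: geometric_def shift_def)

lemma (in shift_space) geometric: "u \<in> V \<Longrightarrow> geometric i a n u \<in> V"
  unfolding geometric_def by (intro sum scale shift) auto

lemma (in shift_space) sup_norm_geometric_le:
  assumes u: "u \<in> V" and l: "l \<noteq> 0"
    and lower: "\<And>u. u \<in> V \<Longrightarrow> d * sup_norm u \<le> sup_norm (\<lambda>j. shift i 1 u j - l * u j)"
  shows "d * sup_norm (geometric i (1 / l) n u) \<le> cmod l * (sup_norm u + sup_norm (shift i n u) / cmod l ^ n)"
proof -
  let ?g = "geometric i (1 / l) n u"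
  have "d * sup_norm ?g \<le> sup_norm (\<lambda>j. shift i 1 ?g j - l * ?g j)"
    by (intro lower geometric u)
  also have "\<dots> \<le> cmod l * (sup_norm u + sup_norm (shift i n u) / cmod l ^ n)"
  proof (rule sup_norm_le)
    fix j
    have "cmod (u j - (1 / l) ^ n * shift i n u j) \<le> cmod (u j) + cmod ((1 / l) ^ n * shift i n u j)"
      by (rule norm_triangle_ineq4)
    also have "\<dots> \<le> sup_norm u + sup_norm (shift i n u) / cmod l ^ n"
      using cmod_le_sup_norm[OF bdd[OF u], of j] cmod_le_sup_norm[OF bdd[OF shift[OF u]], of i n j]
      by (intro add_mono) (simp_all add: norm_mult norm_power norm_divide power_divide divide_right_mono)
    finally show "cmod (shift i 1 ?g j - l * ?g j) \<le> cmod l * (sup_norm u + sup_norm (shift i n u) / cmod l ^ n)"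
      unfolding shift_minus_eigenvalue_geometric[OF l] by (simp add: norm_mult mult_left_mono)
  qed
  finally show ?thesis .
qed

lemma roots_of_unity_sum:
  fixes n m :: nat
  assumes "0 < m" "m < 2 * n"
  shows "(\<Sum>q<n. (cis (2 * pi / n) ^ m) ^ q) = (if m = n then of_nat n else 0)"
proof -
  have n: "n > 0" using assms by auto
  have e: "cis (2 * pi / n) ^ m = exp (2 * of_real pi * \<i> * of_nat m / of_nat n)"
    by (simp only: Complex.DeMoivre) (simp add: cis_conv_exp algebra_simps)
  show ?thesis
  proof (cases "m = n")
    case True
    then have "cis (2 * pi / n) ^ m = 1" unfolding e using n exp_two_pi_i by simp
    then show ?thesis using True by simp
  next
    case False
    have "\<not> n dvd m"
    proof
      assume "n dvd m"
      then obtain k where "m = n * k" by (elim dvdE)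
      with assms False show False by (cases "k = 0 \<or> k = 1") auto
    qed
    hence ne: "cis (2 * pi / n) ^ m \<noteq> 1"
      using complex_root_unity_eq_1[of n m] n unfolding e by simp
    have "(cis (2 * pi / n) ^ m) ^ n = (cis (2 * pi / n) ^ n) ^ m"
      by (simp add: power_mult[symmetric] mult.commute)
    also have "cis (2 * pi / n) ^ n = 1" using n by (simp add: Complex.DeMoivre)
    finally show ?thesis using ne False by (simp add: geometric_sum)
  qed
qed

text \<open>
  A discrete Cauchy integral. Squaring the geometric sum gives the power \<open>S\<^sup>n\<^sup>-\<^sup>1\<close> the
  coefficient \<open>n\<close>. The weight \<open>w q\<close> turns the exponent \<open>k + l\<close> into \<open>k + l + 1\<close>, which lies strictly
  between 0 and \<open>2n\<close>, so that averaging over the roots of unity keeps the terms with \<open>k + l = n - 1\<close>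
  and no others.
\<close>

lemma average_geometric_geometric:
  fixes n :: nat and r :: real
  assumes n: "n > 0"
  defines "w \<equiv> \<lambda>q::nat. cis (2 * pi / n) ^ q"
  shows "(\<Sum>q<n. w q * geometric i (of_real r * w q) n (geometric i (of_real r * w q) n u) j) =
    of_nat n ^ 2 * of_real r ^ (n - 1) * shift i (n - 1) u j"
proof -
  let ?h = "cis (2 * pi / n)"
  have gg: "geometric i a n (geometric i a n u) j = (\<Sum>k<n. \<Sum>l<n. a ^ (k + l) * shift i (k + l) u j)" for a
    unfolding geometric_def shift_def
    by (simp add: sum_distrib_left power_add mult_ac add_ac)
  have "(\<Sum>q<n. w q * geometric i (of_real r * w q) n (geometric i (of_real r * w q) n u) j) =
      (\<Sum>q<n. \<Sum>k<n. \<Sum>l<n. of_real r ^ (k + l) * shift i (k + l) u j * (?h ^ (k + l + 1)) ^ q)"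
    unfolding gg w_def
    by (simp add: sum_distrib_left power_mult_distrib power_mult[symmetric] power_add[symmetric] mult_ac add_ac)
  also have "\<dots> = (\<Sum>k<n. \<Sum>l<n. \<Sum>q<n. of_real r ^ (k + l) * shift i (k + l) u j * (?h ^ (k + l + 1)) ^ q)"
    by (subst sum.swap, rule sum.cong[OF refl], rule sum.swap)
  also have "\<dots> = (\<Sum>k<n. \<Sum>l<n. of_real r ^ (k + l) * shift i (k + l) u j * (\<Sum>q<n. (?h ^ (k + l + 1)) ^ q))"
    by (simp only: sum_distrib_left)
  also have "\<dots> = (\<Sum>k<n. \<Sum>l<n. if l = n - 1 - k then of_real r ^ (n - 1) * shift i (n - 1) u j * of_nat n else 0)"
    by (intro sum.cong refl) (subst roots_of_unity_sum, auto)
  also have "\<dots> = of_nat n ^ 2 * of_real r ^ (n - 1) * shift i (n - 1) u j"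
    using n by (subst sum.delta) (auto simp: power2_eq_square)
  finally show ?thesis .
qed

context shift_space
begin

definition power_bounded :: "'s \<Rightarrow> real \<Rightarrow> real \<Rightarrow> bool" where
  "power_bounded i m A \<longleftrightarrow> (\<forall>u\<in>V. \<forall>k. sup_norm (shift i k u) \<le> A * m ^ k * sup_norm u)"

lemma power_bounded_one: "power_bounded i 1 1"
  by (simp add: power_bounded_def sup_norm_shift_le bdd)

lemma power_bounded_mono:
  assumes "power_bounded i m A" "A \<le> B" "0 \<le> m" shows "power_bounded i m B"
  unfolding power_bounded_def
proof (intro ballI allI)
  fix u k assume u: "u \<in> V"
  have "sup_norm (shift i k u) \<le> A * (m ^ k * sup_norm u)"
    using assms(1) u by (simp add: power_bounded_def mult.assoc)
  also have "\<dots> \<le> B * (m ^ k * sup_norm u)"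
    using assms(2,3) by (intro mult_right_mono mult_nonneg_nonneg sup_norm_nonneg bdd u) auto
  finally show "sup_norm (shift i k u) \<le> B * m ^ k * sup_norm u" by (simp add: mult.assoc)
qed

text \<open>
  With \<open>z = S/l\<close> one has \<open>(1 - z)\<^sup>2 (\<Sum>k<n. z\<^sup>k)\<^sup>2 = (1 - z\<^sup>n)\<^sup>2\<close>. The right side is bounded
  independently of \<open>n\<close>, and dividing by \<open>(1 - z)\<^sup>2\<close> costs the constant factor \<open>1/d\<^sup>2\<close>; yet a weighted
  average of the squared geometric sums over \<open>\<bar>l\<bar> = m\<close> is \<open>n z\<^sup>n\<^sup>-\<^sup>1\<close>. This gains a factor \<open>1/n\<close>. The first
  power of the geometric sum would only give boundedness.
\<close>

lemma shift_decay:
  assumes u: "u \<in> V" and m: "0 < m" "m \<le> 1" and d: "d > 0"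
    and lower: "\<And>l u. cmod l = m \<Longrightarrow> u \<in> V \<Longrightarrow> d * sup_norm u \<le> sup_norm (\<lambda>j. shift i 1 u j - l * u j)"
    and pb: "power_bounded i m A" and A: "A \<ge> 1" and n: "n > 0"
  shows "n * sup_norm (shift i (n - 1) u) \<le> 4 * A / d\<^sup>2 * m ^ (n - 1) * sup_norm u"
proof -
  let ?N = "sup_norm u"
  define w where "w = (\<lambda>q::nat. cis (2 * pi / n) ^ q)"
  define a where "a = (\<lambda>q. of_real (1 / m) * w q)"
  have N: "?N \<ge> 0" by (intro sup_norm_nonneg bdd u)
  have cw: "cmod (w q) = 1" for q by (simp add: w_def norm_power)
  have S: "sup_norm (shift i k u) \<le> A * m ^ k * ?N" for k
    using pb u by (simp add: power_bounded_def)
  have gg: "sup_norm (geometric i (a q) n (geometric i (a q) n u)) \<le> 4 * A / d\<^sup>2 * ?N" for q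
  proof -
    define l where "l = of_real m / w q"
    have l: "cmod l = m" using m cw[of q] by (simp add: l_def norm_divide)
    have l0: "l \<noteq> 0" using l m by auto
    have al: "a q = 1 / l" by (simp add: a_def l_def)
    let ?g = "geometric i (a q) n"
    note bound = sup_norm_geometric_le[OF _ l0 lower[OF l], folded al, unfolded l]
    have "d * sup_norm (?g u) \<le> m * (?N + sup_norm (shift i n u) / m ^ n)"
      by (rule bound[OF u])
    also have "\<dots> \<le> m * (A * ?N + A * ?N)"
      using S[of n] m N mult_right_mono[OF A N] by (intro mult_left_mono add_mono) (auto simp: field_simps)
    finally have 1: "d * sup_norm (?g u) \<le> 2 * A * m * ?N" by (simp add: algebra_simps)
    have "d * sup_norm (?g (shift i n u)) \<le> m * (sup_norm (shift i n u) + sup_norm (shift i n (shift i n u)) / m ^ n)"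
      by (rule bound[OF shift[OF u]])
    also have "\<dots> \<le> m * (A * m ^ n * ?N + A * m ^ n * ?N)"
      using S[of n] S[of "n + n"] m
      by (intro mult_left_mono add_mono) (auto simp: shift_shift field_simps power_add)
    finally have 2: "d * sup_norm (shift i n (?g u)) / m ^ n \<le> 2 * A * m * ?N"
      using m by (simp add: geometric_shift field_simps)
    have "d * (d * sup_norm (?g (?g u))) \<le> d * (m * (sup_norm (?g u) + sup_norm (shift i n (?g u)) / m ^ n))"
      using bound[OF geometric[OF u]] d by (intro mult_left_mono) auto
    also have "\<dots> = m * (d * sup_norm (?g u) + d * sup_norm (shift i n (?g u)) / m ^ n)"
      by (simp add: algebra_simps)
    also have "\<dots> \<le> m * (2 * A * m * ?N + 2 * A * m * ?N)"
      using 1 2 m by (intro mult_left_mono add_mono) auto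
    also have "\<dots> = m * m * (4 * A * ?N)" by simp
    also have "\<dots> \<le> 1 * (4 * A * ?N)"
      using m A N by (intro mult_right_mono mult_le_one) auto
    finally show ?thesis using d by (simp add: field_simps power2_eq_square)
  qed
  have "cmod (shift i (n - 1) u j) \<le> 4 * A / d\<^sup>2 * m ^ (n - 1) * ?N / n" for j
  proof -
    have "of_nat n ^ 2 * of_real (1 / m) ^ (n - 1) * shift i (n - 1) u j =
        (\<Sum>q<n. w q * geometric i (a q) n (geometric i (a q) n u) j)"
      unfolding a_def w_def using average_geometric_geometric[OF n, of i "1/m" u j] by simp
    hence "cmod (of_nat n ^ 2 * of_real (1 / m) ^ (n - 1) * shift i (n - 1) u j) =
        cmod (\<Sum>q<n. w q * geometric i (a q) n (geometric i (a q) n u) j)" by (rule arg_cong)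
    also have "\<dots> \<le> (\<Sum>q<n. 4 * A / d\<^sup>2 * ?N)"
    proof (rule sum_norm_le)
      fix q
      have "cmod (geometric i (a q) n (geometric i (a q) n u) j) \<le> 4 * A / d\<^sup>2 * ?N"
        by (rule order_trans[OF cmod_le_sup_norm[OF bdd[OF geometric[OF geometric[OF u]]]] gg])
      then show "cmod (w q * geometric i (a q) n (geometric i (a q) n u) j) \<le> 4 * A / d\<^sup>2 * ?N"
        by (simp add: norm_mult cw)
    qed
    also have "\<dots> = n * (4 * A / d\<^sup>2 * ?N)" by simp
    finally have *: "real n ^ 2 * (1 / m) ^ (n - 1) * cmod (shift i (n - 1) u j) \<le> n * (4 * A / d\<^sup>2 * ?N)"
      using m by (simp add: norm_mult norm_power norm_divide)
    have "cmod (shift i (n - 1) u j) =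
        (real n ^ 2 * (1 / m) ^ (n - 1) * cmod (shift i (n - 1) u j)) * (m ^ (n - 1) / real n ^ 2)"
      using n m by (simp add: power_divide)
    also have "\<dots> \<le> (n * (4 * A / d\<^sup>2 * ?N)) * (m ^ (n - 1) / real n ^ 2)"
      using * m by (intro mult_right_mono) auto
    also have "\<dots> = 4 * A / d\<^sup>2 * m ^ (n - 1) * ?N / n"
      using n by (simp add: power2_eq_square mult_ac)
    finally show ?thesis .
  qed
  hence "sup_norm (shift i (n - 1) u) \<le> 4 * A / d\<^sup>2 * m ^ (n - 1) * ?N / n" by (rule sup_norm_le)
  hence "n * sup_norm (shift i (n - 1) u) \<le> n * (4 * A / d\<^sup>2 * m ^ (n - 1) * ?N / n)"
    by (rule mult_left_mono) simp
  also have "\<dots> = 4 * A / d\<^sup>2 * m ^ (n - 1) * ?N" using n by simp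
  finally show ?thesis .
qed

text \<open>
  The decay estimate halves the bound for all powers \<open>k \<ge> n0\<close>, and the finitely many remaining powers are
  controlled by the fact that a shift does not increase the norm. Repeating this replaces \<open>A\<close> by a constant
  that depends on \<open>m\<close> and \<open>d\<close> alone, which lets the next lemma pass to a limit in \<open>m\<close>.
\<close>

lemma power_bounded_uniform:
  assumes m: "0 < m" "m \<le> 1" and d: "d > 0"
    and lower: "\<And>l u. cmod l = m \<Longrightarrow> u \<in> V \<Longrightarrow> d * sup_norm u \<le> sup_norm (\<lambda>j. shift i 1 u j - l * u j)"
    and pb: "power_bounded i m A" and n0: "real n0 \<ge> 8 / d\<^sup>2"
  shows "power_bounded i m (1 / m ^ n0)"
proof -
  define P where "P = 1 / m ^ n0"
  have P1: "P \<ge> 1" using m by (simp add: P_def power_le_one)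
  have halve: "power_bounded i m (max (B / 2) P)" if B: "power_bounded i m B" "B \<ge> 1" for B
    unfolding power_bounded_def
  proof (intro ballI allI)
    fix u k assume u: "u \<in> V"
    have N: "sup_norm u \<ge> 0" by (intro sup_norm_nonneg bdd u)
    show "sup_norm (shift i k u) \<le> max (B / 2) P * m ^ k * sup_norm u"
    proof (cases "k < n0")
      case True
      have "sup_norm (shift i k u) \<le> 1 * sup_norm u" using sup_norm_shift_le[OF bdd[OF u]] by simp
      also have "\<dots> \<le> (P * m ^ k) * sup_norm u"
        using m True N by (intro mult_right_mono) (auto simp: P_def field_simps power_decreasing)
      also have "\<dots> \<le> (max (B / 2) P * m ^ k) * sup_norm u"
        using m N by (intro mult_right_mono) auto
      finally show ?thesis .
    next
      case False
      have "Suc k * sup_norm (shift i k u) \<le> 4 * B / d\<^sup>2 * m ^ k * sup_norm u"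
        using shift_decay[OF u m d lower B, of "Suc k"] by simp
      also have "\<dots> = (8 / d\<^sup>2) * (B / 2 * m ^ k * sup_norm u)" by simp
      also have "\<dots> \<le> Suc k * (B / 2 * m ^ k * sup_norm u)"
        using n0 False m N B by (intro mult_right_mono) auto
      finally have "sup_norm (shift i k u) \<le> (B / 2) * (m ^ k * sup_norm u)"
        by (simp add: mult.assoc)
      also have "\<dots> \<le> max (B / 2) P * (m ^ k * sup_norm u)"
        using m N by (intro mult_right_mono) auto
      finally show ?thesis by (simp add: mult.assoc)
    qed
  qed
  have iter: "power_bounded i m (max (A / 2 ^ q) P)" for q
  proof (induction q)
    case 0
    show ?case using power_bounded_mono[OF pb] m by simp
  next
    case (Suc q)
    from halve[OF Suc] P1 have "power_bounded i m (max (max (A / 2 ^ q) P / 2) P)" by simp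
    also have "max (max (A / 2 ^ q) P / 2) P = max (A / 2 ^ Suc q) P" using P1 by (auto simp: max_def)
    finally show ?case .
  qed
  obtain q where "A < 2 ^ q" using real_arch_pow[of 2 A] by auto
  hence "A / 2 ^ q < 1" by simp
  hence "max (A / 2 ^ q) P = P" using P1 by linarith
  with iter[of q] show ?thesis by (simp add: P_def)
qed

text \<open>
  The spectral radius is at most \<open>e\<close>. Take the infimum \<open>r\<close> of the radii \<open>m \<ge> e\<close> at which the powers are
  bounded by a multiple of \<open>m\<^sup>k\<close>. By uniformity \<open>r\<close> is itself such a radius. The decay estimate then gives a
  power of norm at most \<open>r\<^sup>k/2\<close>, so a radius slightly below \<open>r\<close> would do as well, unless \<open>r = e\<close>.
\<close>

lemma power_bounded_if_no_eigenvalue: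
  assumes e: "0 < e" "e \<le> 1"
    and no_eig: "\<And>l u. e \<le> cmod l \<Longrightarrow> cmod l \<le> 1 \<Longrightarrow> u \<in> V \<Longrightarrow>
      shift i 1 u = (\<lambda>j. l * u j) \<Longrightarrow> u = (\<lambda>_. 0)"
  obtains B where "power_bounded i e B"
proof -
  have "compact (cball 0 1 - ball (0::complex) e)" by (intro compact_diff) auto
  then obtain d where d: "d > 0" and lower0: "\<And>l u. l \<in> cball 0 1 - ball 0 e \<Longrightarrow> u \<in> V \<Longrightarrow>
      d * sup_norm u \<le> sup_norm (\<lambda>j. shift i 1 u j - l * u j)"
  proof (rule shift_minus_eigenvalue_bounded_below[of _ i])
    fix l u assume "l \<in> cball 0 1 - ball (0::complex) e" "u \<in> V" "shift i 1 u = (\<lambda>j. l * u j)"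
    then show "u = (\<lambda>_. 0)" by (intro no_eig[of l]) auto
  qed blast
  \<comment> \<open>Radii above the spectral radius, cut off at \<open>e\<close> because the lower bound \<open>d\<close> holds on \<open>e \<le> \<bar>l\<bar> \<le> 1\<close>.\<close>
  define M where "M = {m. e \<le> m \<and> m \<le> 1 \<and> (\<exists>A. power_bounded i m A)}"
  define n0 where "n0 = nat \<lceil>8 / d\<^sup>2\<rceil>"
  define P where "P = 1 / e ^ n0"
  have P1: "P \<ge> 1" using e by (simp add: P_def power_le_one)
  have n0: "real n0 \<ge> 8 / d\<^sup>2" unfolding n0_def by linarith
  have lower: "d * sup_norm u \<le> sup_norm (\<lambda>j. shift i 1 u j - l * u j)"
    if "cmod l = m" "e \<le> m" "m \<le> 1" "u \<in> V" for l m u using that by (intro lower0) auto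
  have unif: "power_bounded i m P" if "m \<in> M" for m
  proof -
    from that obtain A where m: "e \<le> m" "m \<le> 1" and A: "power_bounded i m A" by (auto simp: M_def)
    have "power_bounded i m (1 / m ^ n0)"
      by (rule power_bounded_uniform[OF _ m(2) d _ A n0]) (use m e lower in auto)
    moreover have "1 / m ^ n0 \<le> P" unfolding P_def using m e by (intro divide_left_mono power_mono) auto
    ultimately show ?thesis using power_bounded_mono m e by auto
  qed
  have one: "1 \<in> M" using power_bounded_one e by (auto simp: M_def)
  have bb: "bdd_below M" unfolding M_def by (rule bdd_belowI[of _ e]) auto
  define r where "r = Inf M"
  have re: "e \<le> r" unfolding r_def by (rule cInf_greatest) (use one in \<open>auto simp: M_def\<close>)
  have r1: "r \<le> 1" unfolding r_def by (rule cInf_lower[OF one bb])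
  have "r \<in> closure M" unfolding r_def by (rule closure_contains_Inf) (use one bb in auto)
  then obtain s where s: "\<And>n. s n \<in> M" and sr: "s \<longlonglongrightarrow> r" unfolding closure_sequential by auto
  have pbr: "power_bounded i r P"
    unfolding power_bounded_def
  proof (intro ballI allI)
    fix u k assume u: "u \<in> V"
    have "(\<lambda>n. P * s n ^ k * sup_norm u) \<longlonglongrightarrow> P * r ^ k * sup_norm u" by (intro tendsto_intros sr)
    then show "sup_norm (shift i k u) \<le> P * r ^ k * sup_norm u"
      by (rule LIMSEQ_le_const) (use unif[OF s] u in \<open>auto simp: power_bounded_def\<close>)
  qed
  have "r = e"
  proof (rule ccontr)
    assume "r \<noteq> e"
    with re have r: "e < r" by simp
    define k where "k = Suc (nat \<lceil>8 * P / d\<^sup>2\<rceil>)"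
    have k: "real (Suc k) \<ge> 8 * P / d\<^sup>2" unfolding k_def by linarith
    have k0: "k > 0" by (simp add: k_def)
    have half: "sup_norm (shift i k u) \<le> r ^ k / 2 * sup_norm u" if u: "u \<in> V" for u
    proof -
      have N: "sup_norm u \<ge> 0" by (intro sup_norm_nonneg bdd u)
      have "Suc k * sup_norm (shift i k u) \<le> 4 * P / d\<^sup>2 * r ^ k * sup_norm u"
        using shift_decay[OF u _ r1 d _ pbr P1, of "Suc k"] lower[OF _ re r1] r e by simp
      also have "\<dots> = (8 * P / d\<^sup>2) * (r ^ k / 2 * sup_norm u)" by simp
      also have "\<dots> \<le> Suc k * (r ^ k / 2 * sup_norm u)"
        using k r e N by (intro mult_right_mono) auto
      finally show ?thesis by simp
    qed
    \<comment> \<open>The \<open>k\<close>-th root spreads the gain of one half in the \<open>k\<close>-th power over a single step.\<close>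
    define m where "m = max e (r * root k (1/2))"
    have rt: "0 < root k (1/2)" "root k (1/2) < 1" "root k (1/2) ^ k = 1/2" using k0 by auto
    have m: "e \<le> m" "m < r" "m \<le> 1" "0 < m" using r rt r1 e mult_le_one[of r "root k (1/2)"] by (auto simp: m_def)
    have mk: "r ^ k / 2 \<le> m ^ k"
    proof -
      have "r ^ k / 2 = (r * root k (1/2)) ^ k" using rt by (simp add: power_mult_distrib)
      also have "\<dots> \<le> m ^ k" using r e rt by (intro power_mono) (auto simp: m_def)
      finally show ?thesis .
    qed
    have iter: "sup_norm (shift i (k * q) u) \<le> m ^ (k * q) * sup_norm u" if u: "u \<in> V" for u q
    proof (induction q)
      case (Suc q)
      have "sup_norm (shift i (k * Suc q) u) = sup_norm (shift i k (shift i (k * q) u))"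
        by (simp add: shift_shift)
      also have "\<dots> \<le> r ^ k / 2 * sup_norm (shift i (k * q) u)" by (rule half[OF shift[OF u]])
      also have "\<dots> \<le> m ^ k * (m ^ (k * q) * sup_norm u)"
        using mk Suc m by (intro mult_mono sup_norm_nonneg bdd shift u) auto
      finally show ?case by (simp add: power_add mult.assoc)
    qed simp
    have "power_bounded i m (1 / m ^ k)"
      unfolding power_bounded_def
    proof (intro ballI allI)
      fix u n assume u: "u \<in> V"
      have N: "sup_norm u \<ge> 0" by (intro sup_norm_nonneg bdd u)
      have n: "n mod k + k * (n div k) = n" by simp
      have "sup_norm (shift i n u) = sup_norm (shift i (n mod k) (shift i (k * (n div k)) u))"
        by (simp add: shift_shift)
      also have "\<dots> \<le> sup_norm (shift i (k * (n div k)) u)"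
        by (intro sup_norm_shift_le bdd shift u)
      also have "\<dots> \<le> m ^ (k * (n div k)) * sup_norm u" by (rule iter[OF u])
      also have "\<dots> \<le> (1 / m ^ k * m ^ n) * sup_norm u"
      proof (intro mult_right_mono N)
        have "m ^ k \<le> m ^ (n mod k)" using k0 m by (intro power_decreasing) auto
        hence "m ^ k * m ^ (k * (n div k)) \<le> m ^ (n mod k) * m ^ (k * (n div k))"
          using m by (intro mult_right_mono) auto
        also have "\<dots> = m ^ n" by (simp add: power_add[symmetric])
        finally show "m ^ (k * (n div k)) \<le> 1 / m ^ k * m ^ n" using m by (simp add: field_simps)
      qed
      finally show "sup_norm (shift i n u) \<le> 1 / m ^ k * m ^ n * sup_norm u" .
    qed
    hence "m \<in> M" using m by (auto simp: M_def)
    hence "r \<le> m" unfolding r_def by (intro cInf_lower bb)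
    with m show False by simp
  qed
  with pbr that show ?thesis by simp
qed

end

section \<open>Joint eigenvectors and annihilators of power series\<close>

text \<open>
  This plays the part of the Gelfand-Mazur theorem. If there were no eigenvalue, \<open>S\<close> would be bounded below by
  some \<open>d\<close>, hence \<open>S\<^sup>k\<close> by \<open>d\<^sup>k\<close>, although the spectral radius is at most \<open>d/2\<close>.
\<close>

lemma (in shift_space) eigenvalue_exists:
  assumes "v \<in> V" "v \<noteq> (\<lambda>_. 0)"
  obtains l u where "u \<in> V" "u \<noteq> (\<lambda>_. 0)" "shift i 1 u = (\<lambda>j. l * u j)"
proof (rule ccontr)
  assume "\<not> thesis"
  with that have no_eig: "u = (\<lambda>_. 0)" if "u \<in> V" "shift i 1 u = (\<lambda>j. l * u j)" for l u
    using that by blast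
  obtain d where d: "d > 0" and lower: "\<And>l u. l \<in> {0} \<Longrightarrow> u \<in> V \<Longrightarrow>
      d * sup_norm u \<le> sup_norm (\<lambda>j. shift i 1 u j - l * u j)"
  proof (rule shift_minus_eigenvalue_bounded_below[of "{0}" i])
    fix l u assume "u \<in> V" "shift i 1 u = (\<lambda>j. l * u j)"
    then show "u = (\<lambda>_. 0)" by (rule no_eig)
  qed auto
  define e where "e = min (d / 2) 1"
  have e: "0 < e" "e \<le> 1" "2 * e \<le> d" using d by (auto simp: e_def)
  obtain B where B: "power_bounded i e B"
  proof (rule power_bounded_if_no_eigenvalue[of e i])
    fix l u assume "u \<in> V" "shift i 1 u = (\<lambda>j. l * u j)"
    then show "u = (\<lambda>_. 0)" by (rule no_eig)
  qed (use e in auto)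
  have N: "sup_norm v > 0"
    using sup_norm_eq_0[OF bdd[OF assms(1)]] assms(2) by force
  have low: "d ^ k * sup_norm v \<le> sup_norm (shift i k v)" for k
  proof (induction k)
    case (Suc k)
    have "d ^ Suc k * sup_norm v \<le> d * sup_norm (shift i k v)"
      using Suc d by simp
    also have "\<dots> \<le> sup_norm (shift i 1 (shift i k v))"
      using lower[of 0 "shift i k v"] shift[OF assms(1)] by simp
    finally show ?case by (simp add: shift_shift)
  qed simp
  have "2 ^ k \<le> B" for k
  proof -
    have "(2 * e) ^ k * sup_norm v \<le> d ^ k * sup_norm v"
      using e N by (intro mult_right_mono power_mono) auto
    also have "\<dots> \<le> B * e ^ k * sup_norm v"
      using low[of k] B assms(1) unfolding power_bounded_def by (meson order_trans)
    finally show ?thesis using e N by (simp add: power_mult_distrib)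
  qed
  moreover obtain k where "B < 2 ^ k" using real_arch_pow[of 2 B] by auto
  ultimately show False by (meson not_le)
qed

lemma (in shift_space) shift_space_eigenspace: "shift_space {u \<in> V. shift i 1 u = (\<lambda>j. l * u j)}"
proof
  fix u k assume u: "u \<in> {u \<in> V. shift i 1 u = (\<lambda>j. l * u j)}"
  have "shift i 1 (shift k 1 u) = shift k 1 (shift i 1 u)"
    by (auto simp: shift_def fun_eq_iff fun_upd_twist)
  also have "shift i 1 u = (\<lambda>j. l * u j)" using u by simp
  also have "shift k 1 (\<lambda>j. l * u j) = (\<lambda>j. l * shift k 1 u j)" by (simp add: shift_def)
  finally show "shift k 1 u \<in> {u \<in> V. shift i 1 u = (\<lambda>j. l * u j)}"
    using u shift_once[of u k] by simp
next
  fix U :: "nat \<Rightarrow> _" and u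
  assume U: "\<And>n. U n \<in> {u \<in> V. shift i 1 u = (\<lambda>j. l * u j)}" "\<And>n j. cmod (U n j) \<le> 1"
    and lim: "\<And>j. (\<lambda>n. U n j) \<longlonglongrightarrow> u j"
  have "u \<in> V" by (rule limit[OF _ _ lim]) (use U in auto)
  moreover have "shift i 1 u j = l * u j" for j
  proof (rule LIMSEQ_unique)
    show "(\<lambda>n. shift i 1 (U n) j) \<longlonglongrightarrow> shift i 1 u j" unfolding shift_def by (rule lim)
    show "(\<lambda>n. shift i 1 (U n) j) \<longlonglongrightarrow> l * u j" using U by (auto intro!: tendsto_intros lim)
  qed
  ultimately show "u \<in> {u \<in> V. shift i 1 u = (\<lambda>j. l * u j)}" by auto
qed (use bdd zero add scale in \<open>auto simp: shift_def fun_eq_iff algebra_simps\<close>)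

lemma joint_eigenspace_exists:
  fixes V :: "(('s::finite \<Rightarrow> nat) \<Rightarrow> complex) set"
  assumes "shift_space V" "v \<in> V" "v \<noteq> (\<lambda>_. 0)"
  shows "\<exists>W l w. shift_space W \<and> W \<subseteq> V \<and> w \<in> W \<and> w \<noteq> (\<lambda>_. 0) \<and>
    (\<forall>i\<in>A. \<forall>u\<in>W. shift i 1 u = (\<lambda>j. l i * u j))"
proof -
  have "finite A" by simp
  then show ?thesis
  proof (induction A rule: finite_induct)
    case empty
    then show ?case using assms by blast
  next
    case (insert a A)
    then obtain W l w where W: "shift_space W" "W \<subseteq> V" "w \<in> W" "w \<noteq> (\<lambda>_. 0)"
      and eig: "\<And>i u. i \<in> A \<Longrightarrow> u \<in> W \<Longrightarrow> shift i 1 u = (\<lambda>j. l i * u j)" by blast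
    interpret shift_space W by fact
    obtain m u where u: "u \<in> W" "u \<noteq> (\<lambda>_. 0)" "shift a 1 u = (\<lambda>j. m * u j)"
      using eigenvalue_exists[OF W(3,4)] by blast
    let ?W = "{u \<in> W. shift a 1 u = (\<lambda>j. m * u j)}"
    have "\<forall>i\<in>insert a A. \<forall>u\<in>?W. shift i 1 u = (\<lambda>j. (l(a := m)) i * u j)"
      using eig insert.hyps by (auto simp: fun_eq_iff)
    moreover have "shift_space ?W" by (rule shift_space_eigenspace)
    ultimately show ?case using W(2) u by (intro exI[of _ ?W] exI[of _ "l(a := m)"] exI[of _ u]) auto
  qed
qed

lemma joint_eigenvector_eq_monomials:
  fixes u :: "('s::finite \<Rightarrow> nat) \<Rightarrow> complex"
  assumes eig: "\<And>i. shift i 1 u = (\<lambda>j. l i * u j)"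
  shows "u j = u (\<lambda>_. 0) * (\<Prod>i\<in>UNIV. l i ^ j i)"
proof -
  have pow: "u (j(i := j i + k)) = l i ^ k * u j" for i j k
  proof (induction k)
    case (Suc k)
    have "u (j(i := j i + Suc k)) = shift i 1 u (j(i := j i + k))" by (simp add: shift_def)
    also have "\<dots> = l i * u (j(i := j i + k))" by (simp only: eig)
    finally show ?case using Suc by (simp only: power_Suc mult.assoc)
  qed simp
  have "u (\<lambda>i. if i \<in> A then j i else 0) = u (\<lambda>_. 0) * (\<Prod>i\<in>A. l i ^ j i)" if "finite A" for A
    using that
  proof (induction A rule: finite_induct)
    case (insert a A)
    let ?j = "\<lambda>i. if i \<in> A then j i else 0"
    have "(\<lambda>i. if i \<in> insert a A then j i else 0) = ?j(a := ?j a + j a)"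
      using insert.hyps by auto
    then have "u (\<lambda>i. if i \<in> insert a A then j i else 0) = u (?j(a := ?j a + j a))" by (rule arg_cong)
    also have "\<dots> = l a ^ j a * u ?j" by (rule pow)
    finally show ?case using insert by simp
  qed simp
  from this[of UNIV] show ?thesis by simp
qed

text \<open>
  Dominated convergence, which makes the annihilator of an absolutely summable series closed under bounded
  pointwise limits.
\<close>

lemma infsum_bounded_pointwise_limit:
  fixes w :: "'b \<Rightarrow> complex"
  assumes w: "(\<lambda>j. cmod (w j)) summable_on UNIV"
    and U: "\<And>n j. cmod (U n j) \<le> 1" and lim: "\<And>j. (\<lambda>n. U n j) \<longlonglongrightarrow> u j"
  shows "(\<lambda>n. \<Sum>\<^sub>\<infinity>j. U n j * w j) \<longlonglongrightarrow> (\<Sum>\<^sub>\<infinity>j. u j * w j)"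
proof (rule LIMSEQ_I)
  fix e :: real assume e: "e > 0"
  have u: "cmod (u j) \<le> 1" for j
    by (rule LIMSEQ_le_const2[OF tendsto_norm[OF lim]]) (use U in auto)
  have sm: "(\<lambda>j. c j * w j) summable_on UNIV" if "\<And>j. cmod (c j) \<le> B" for c :: "'b \<Rightarrow> complex" and B
  proof (rule abs_summable_summable, rule Infinite_Sum.abs_summable_on_comparison_test)
    show "(\<lambda>j. norm (B * w j)) summable_on UNIV" using summable_on_cmult_right[OF w, of "\<bar>B\<bar>"] by (simp add: norm_mult)
    show "cmod (c j * w j) \<le> cmod (complex_of_real B * w j)" for j
      using that[of j] by (simp add: norm_mult mult_right_mono)
  qed
  obtain A where A: "finite A" and "dist (\<Sum>j\<in>A. cmod (w j)) (\<Sum>\<^sub>\<infinity>j. cmod (w j)) \<le> e / 5"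
    using infsum_finite_approximation[OF w, of "e / 5"] e by auto
  moreover have "(\<Sum>\<^sub>\<infinity>j. cmod (w j)) = (\<Sum>j\<in>A. cmod (w j)) + (\<Sum>\<^sub>\<infinity>j\<in>-A. cmod (w j))"
    using infsum_Un_disjoint[of "\<lambda>j. cmod (w j)" A "-A"] A summable_on_subset_banach[OF w] by simp
  ultimately have tail: "(\<Sum>\<^sub>\<infinity>j\<in>-A. cmod (w j)) \<le> e / 5" by (simp add: dist_real_def)
  have "(\<lambda>n. \<Sum>j\<in>A. cmod (U n j - u j) * cmod (w j)) \<longlonglongrightarrow> (\<Sum>j\<in>A. cmod (u j - u j) * cmod (w j))"
    by (intro tendsto_intros lim)
  then obtain N where N: "\<And>n. n \<ge> N \<Longrightarrow> (\<Sum>j\<in>A. cmod (U n j - u j) * cmod (w j)) < e / 5"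
    using LIMSEQ_D[of _ 0 "e / 5"] e by (fastforce simp: sum_nonneg)
  have "norm ((\<Sum>\<^sub>\<infinity>j. U n j * w j) - (\<Sum>\<^sub>\<infinity>j. u j * w j)) < e" if n: "n \<ge> N" for n
  proof -
    have c: "cmod (U n j - u j) \<le> 2" for j using norm_triangle_ineq4[of "U n j" "u j"] U[of n j] u[of j] by linarith
    let ?f = "\<lambda>j. (U n j - u j) * w j"
    have sf: "?f summable_on UNIV" by (rule sm[OF c])
    have "(\<Sum>\<^sub>\<infinity>j. U n j * w j) - (\<Sum>\<^sub>\<infinity>j. u j * w j) = infsum ?f UNIV"
      using infsum_add[OF sf sm[of u 1, OF u]] by (simp add: algebra_simps)
    also have "\<dots> = (\<Sum>j\<in>A. ?f j) + infsum ?f (-A)"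
      using infsum_Un_disjoint[of ?f A "-A"] A summable_on_subset_banach[OF sf] by simp
    finally have "norm ((\<Sum>\<^sub>\<infinity>j. U n j * w j) - (\<Sum>\<^sub>\<infinity>j. u j * w j)) \<le> norm (\<Sum>j\<in>A. ?f j) + norm (infsum ?f (-A))"
      by (simp add: norm_triangle_ineq)
    also have "norm (\<Sum>j\<in>A. ?f j) \<le> (\<Sum>j\<in>A. cmod (U n j - u j) * cmod (w j))"
      by (rule sum_norm_le) (simp add: norm_mult)
    also have "\<dots> < e / 5" by (rule N[OF n])
    also have "norm (infsum ?f (-A)) \<le> (\<Sum>\<^sub>\<infinity>j\<in>-A. 2 * cmod (w j))"
    proof (rule norm_infsum_le)
      show "(?f has_sum infsum ?f (-A)) (-A)" using summable_on_subset_banach[OF sf] by (intro has_sum_infsum) auto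
      show "((\<lambda>j. 2 * cmod (w j)) has_sum (\<Sum>\<^sub>\<infinity>j\<in>-A. 2 * cmod (w j))) (-A)"
        using summable_on_subset_banach[OF w] by (intro has_sum_infsum summable_on_cmult_right) auto
    qed (use c in \<open>auto simp: norm_mult intro!: mult_right_mono\<close>)
    also have "\<dots> = 2 * (\<Sum>\<^sub>\<infinity>j\<in>-A. cmod (w j))" by (rule infsum_cmult_right')
    finally show ?thesis using tail e by linarith
  qed
  then show "\<exists>N. \<forall>n\<ge>N. norm ((\<Sum>\<^sub>\<infinity>j. U n j * w j) - (\<Sum>\<^sub>\<infinity>j. u j * w j)) < e" by blast
qed

text \<open>
  Translating \<open>u\<close> by \<open>m\<close> amounts to multiplying the power series \<open>w\<close> by the monomial of exponent \<open>m\<close>. So \<open>u\<close>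
  annihilates the whole ideal generated by \<open>\<Psi>\<close>.
\<close>

definition annihilates :: "(('s \<Rightarrow> nat) \<Rightarrow> complex) \<Rightarrow> (('s \<Rightarrow> nat) \<Rightarrow> complex) set \<Rightarrow> bool" where
  "annihilates u \<Psi> \<longleftrightarrow> (\<forall>w\<in>\<Psi>. \<forall>m. ((\<lambda>j. u (\<lambda>i. j i + m i) * w j) has_sum 0) UNIV)"

lemma annihilates_add:
  "annihilates u \<Psi> \<Longrightarrow> annihilates v \<Psi> \<Longrightarrow> annihilates (\<lambda>j. u j + v j) \<Psi>"
  by (auto simp: annihilates_def distrib_right intro!: has_sum_add[where a=0 and b=0, simplified])

lemma annihilates_scale: "annihilates u \<Psi> \<Longrightarrow> annihilates (\<lambda>j. a * u j) \<Psi>"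
  using has_sum_cmult_right[where c=a and a=0] by (fastforce simp: annihilates_def mult.assoc)

lemma annihilates_shift:
  assumes "annihilates u \<Psi>" shows "annihilates (shift i 1 u) \<Psi>"
  unfolding annihilates_def
proof (intro ballI allI)
  fix w m assume "w \<in> \<Psi>"
  with assms have *: "((\<lambda>j. u (\<lambda>k. j k + (m(i := m i + 1)) k) * w j) has_sum 0) UNIV"
    by (simp only: annihilates_def)
  have "(\<lambda>k. j k + m k)(i := j i + m i + 1) = (\<lambda>k. j k + (m(i := m i + 1)) k)" for j by auto
  then show "((\<lambda>j. shift i 1 u (\<lambda>i. j i + m i) * w j) has_sum 0) UNIV"
    using * by (simp add: shift_def)
qed

lemma shift_space_annihilator:
  fixes \<Psi> :: "(('s::finite \<Rightarrow> nat) \<Rightarrow> complex) set"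
  assumes \<Psi>: "\<And>w. w \<in> \<Psi> \<Longrightarrow> (\<lambda>j. cmod (w j)) summable_on UNIV"
  shows "shift_space {u. bdd_family u \<and> annihilates u \<Psi>}"
proof
  fix u v assume uv: "u \<in> {u. bdd_family u \<and> annihilates u \<Psi>}" "v \<in> {u. bdd_family u \<and> annihilates u \<Psi>}"
  have "bdd_family (\<lambda>j. u j + v j)"
    by (rule bdd_familyI[of _ "sup_norm u + sup_norm v"])
       (use uv in \<open>auto intro!: norm_triangle_mono cmod_le_sup_norm\<close>)
  moreover have "annihilates (\<lambda>j. u j + v j) \<Psi>" using uv by (auto intro: annihilates_add)
  ultimately show "(\<lambda>j. u j + v j) \<in> {u. bdd_family u \<and> annihilates u \<Psi>}" by simp
next
  fix u a assume u: "u \<in> {u. bdd_family u \<and> annihilates u \<Psi>}"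
  have "bdd_family (\<lambda>j. a * u j)"
    by (rule bdd_familyI[of _ "cmod a * sup_norm u"])
       (use u in \<open>auto simp: norm_mult intro!: mult_left_mono cmod_le_sup_norm\<close>)
  moreover have "annihilates (\<lambda>j. a * u j) \<Psi>" using u by (auto intro: annihilates_scale)
  ultimately show "(\<lambda>j. a * u j) \<in> {u. bdd_family u \<and> annihilates u \<Psi>}" by simp
next
  fix u i assume u: "u \<in> {u. bdd_family u \<and> annihilates u \<Psi>}"
  then have "annihilates (shift i 1 u) \<Psi>" by (intro annihilates_shift) simp
  then show "shift i 1 u \<in> {u. bdd_family u \<and> annihilates u \<Psi>}"
    using u bdd_family_shift by auto
next
  fix U :: "nat \<Rightarrow> _" and u
  assume U: "\<And>n. U n \<in> {u. bdd_family u \<and> annihilates u \<Psi>}" "\<And>n j. cmod (U n j) \<le> 1"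
    and lim: "\<And>j. (\<lambda>n. U n j) \<longlonglongrightarrow> u j"
  have u: "cmod (u j) \<le> 1" for j
    by (rule LIMSEQ_le_const2[OF tendsto_norm[OF lim]]) (use U in auto)
  have "annihilates u \<Psi>"
    unfolding annihilates_def
  proof (intro ballI allI)
    fix w m assume w: "w \<in> \<Psi>"
    have "(\<lambda>j. u (\<lambda>i. j i + m i) * w j) summable_on UNIV"
      by (rule abs_summable_summable, rule Infinite_Sum.abs_summable_on_comparison_test[OF \<Psi>[OF w]])
         (use u in \<open>simp add: norm_mult mult_left_le_one_le\<close>)
    moreover have "(\<Sum>\<^sub>\<infinity>j. u (\<lambda>i. j i + m i) * w j) = 0"
    proof (rule LIMSEQ_unique)
      show "(\<lambda>n. \<Sum>\<^sub>\<infinity>j. U n (\<lambda>i. j i + m i) * w j) \<longlonglongrightarrow> (\<Sum>\<^sub>\<infinity>j. u (\<lambda>i. j i + m i) * w j)"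
        by (intro infsum_bounded_pointwise_limit \<Psi> w U(2) lim)
      have "(\<Sum>\<^sub>\<infinity>j. U n (\<lambda>i. j i + m i) * w j) = 0" for n
        using U(1)[of n] w by (auto simp: annihilates_def intro!: infsumI)
      then show "(\<lambda>n. \<Sum>\<^sub>\<infinity>j. U n (\<lambda>i. j i + m i) * w j) \<longlonglongrightarrow> 0" by simp
    qed
    ultimately show "((\<lambda>j. u (\<lambda>i. j i + m i) * w j) has_sum 0) UNIV"
      by (metis has_sum_infsum)
  qed
  then show "u \<in> {u. bdd_family u \<and> annihilates u \<Psi>}" using bdd_familyI[OF u] by simp
qed (auto simp: annihilates_def bdd_family_def)

text \<open>
  The Nullstellensatz in dual form: if the power series in \<open>\<Psi>\<close> have no common zero in the closed unit
  polydisc except 0, then modulo their ideal the monomials in a finite box span everything.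
\<close>

theorem annihilator_determined_on_box:
  fixes \<Psi> :: "(('s::finite \<Rightarrow> nat) \<Rightarrow> complex) set"
  assumes \<Psi>: "\<And>w. w \<in> \<Psi> \<Longrightarrow> (\<lambda>j. cmod (w j)) summable_on UNIV"
    and zeros: "\<And>l. (\<And>i. cmod (l i) \<le> 1) \<Longrightarrow>
      (\<And>w. w \<in> \<Psi> \<Longrightarrow> ((\<lambda>j. w j * (\<Prod>i\<in>UNIV. l i ^ j i)) has_sum 0) UNIV) \<Longrightarrow> l = (\<lambda>_. 0)"
  shows "\<exists>N::nat. \<forall>u. bdd_family u \<longrightarrow> annihilates u \<Psi> \<longrightarrow>
    (\<forall>j. (\<forall>i. j i < N) \<longrightarrow> u j = 0) \<longrightarrow> u = (\<lambda>_. 0)"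
proof -
  define V where "V = {u. bdd_family u \<and> annihilates u \<Psi>}"
  interpret shift_space V unfolding V_def by (rule shift_space_annihilator[OF \<Psi>])
  \<comment> \<open>An eigenvector of one shift yields a joint eigenvector with the same eigenvalue for that shift, that is, a zero.\<close>
  have no_eig: "u = (\<lambda>_. 0)" if l: "1/2 \<le> cmod l" and u: "u \<in> V" "shift i 1 u = (\<lambda>j. l * u j)" for l u i
  proof (rule ccontr)
    assume "u \<noteq> (\<lambda>_. 0)"
    with u joint_eigenspace_exists[OF shift_space_eigenspace[of i l], of u UNIV]
    obtain k v where v: "v \<in> V" "shift i 1 v = (\<lambda>j. l * v j)" "v \<noteq> (\<lambda>_. 0)"
      and eig: "\<And>i. shift i 1 v = (\<lambda>j. k i * v j)" by blast
    have mon: "v j = v (\<lambda>_. 0) * (\<Prod>i\<in>UNIV. k i ^ j i)" for j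
      by (rule joint_eigenvector_eq_monomials[OF eig])
    obtain j0 where j0: "v j0 \<noteq> 0" using v(3) by auto
    have v0: "v (\<lambda>_. 0) \<noteq> 0" using mon[of j0] j0 by auto
    have "k = (\<lambda>_. 0)"
    proof (rule zeros)
      fix i
      have N: "sup_norm v > 0"
        using sup_norm_eq_0[OF bdd[OF v(1)]] v(3) by force
      have "cmod (k i) * cmod (v j) \<le> sup_norm v" for j
        using cmod_le_sup_norm[OF bdd[OF shift[OF v(1)]], of i 1 j] sup_norm_shift_le[OF bdd[OF v(1)], of i 1]
        unfolding eig by (simp add: norm_mult)
      show "cmod (k i) \<le> 1"
      proof (rule ccontr)
        assume k: "\<not> cmod (k i) \<le> 1"
        then have k0: "cmod (k i) > 0" by linarith
        have "sup_norm v \<le> sup_norm v / cmod (k i)"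
          using \<open>\<And>j. cmod (k i) * cmod (v j) \<le> sup_norm v\<close>
          by (intro sup_norm_le) (simp add: pos_le_divide_eq[OF k0] mult.commute)
        with k N show False by (simp add: pos_le_divide_eq[OF k0])
      qed
    next
      fix w assume "w \<in> \<Psi>"
      with v(1) have "((\<lambda>j. v (\<lambda>i. j i + (\<lambda>_. 0) i) * w j) has_sum 0) UNIV"
        by (simp only: V_def annihilates_def mem_Collect_eq)
      then have "((\<lambda>j. v j * w j) has_sum 0) UNIV" by simp
      then have "((\<lambda>j. 1 / v (\<lambda>_. 0) * (v j * w j)) has_sum 1 / v (\<lambda>_. 0) * 0) UNIV"
        by (rule has_sum_cmult_right)
      moreover have "1 / v (\<lambda>_. 0) * (v j * w j) = w j * (\<Prod>i\<in>UNIV. k i ^ j i)" for j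
        using v0 by (subst mon) simp
      ultimately show "((\<lambda>j. w j * (\<Prod>i\<in>UNIV. k i ^ j i)) has_sum 0) UNIV" by simp
    qed
    moreover have "l * v j0 = k i * v j0" using fun_cong[OF v(2), of j0] fun_cong[OF eig[of i], of j0] by simp
    ultimately have "l * v j0 = 0" by simp
    with j0 l show False by simp
  qed
  have "\<exists>n. \<forall>u\<in>V. sup_norm (shift i n u) \<le> 1/2 * sup_norm u" for i
  proof -
    obtain B where B: "power_bounded i (1/2) B"
      by (rule power_bounded_if_no_eigenvalue[of "1/2" i]) (use no_eig in auto)
    obtain n where "B < 2 ^ n" using real_arch_pow[of 2 B] by auto
    then have "B * (1/2) ^ Suc n \<le> 1/2" by (simp add: power_one_over field_simps)
    then have "sup_norm (shift i (Suc n) u) \<le> 1/2 * sup_norm u" if "u \<in> V" for u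
      using B that sup_norm_nonneg[OF bdd[OF that]] mult_right_mono order_trans
      unfolding power_bounded_def by blast
    then show ?thesis by blast
  qed
  then obtain n where n: "\<And>i u. u \<in> V \<Longrightarrow> sup_norm (shift i (n i) u) \<le> 1/2 * sup_norm u" by metis
  show ?thesis
  proof (intro exI[of _ "Max (range n)"] allI impI)
    fix u assume "bdd_family u" "annihilates u \<Psi>" and box: "\<forall>j. (\<forall>i. j i < Max (range n)) \<longrightarrow> u j = 0"
    then have u: "u \<in> V" by (simp add: V_def)
    have "cmod (u j) \<le> 1/2 * sup_norm u" for j
    proof (cases "\<forall>i. j i < Max (range n)")
      case True
      then show ?thesis using box sup_norm_nonneg[OF bdd[OF u]] by simp
    next
      case False
      then obtain i where "Max (range n) \<le> j i" by (auto simp: not_less)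
      moreover have "n i \<le> Max (range n)" by simp
      ultimately have "n i \<le> j i" by linarith
      then have "u j = shift i (n i) u (j(i := j i - n i))" by (simp add: shift_def)
      also have "cmod \<dots> \<le> sup_norm (shift i (n i) u)" by (intro cmod_le_sup_norm bdd shift u)
      also have "\<dots> \<le> 1/2 * sup_norm u" by (rule n[OF u])
      finally show ?thesis .
    qed
    then have "sup_norm u \<le> 1/2 * sup_norm u" by (rule sup_norm_le)
    then show "u = (\<lambda>_. 0)" by (intro sup_norm_eq_0 bdd u) auto
  qed
qed

section \<open>Dual spaces as annihilators\<close>

lemma lookup_anti_diff:
  "Poly_Mapping.lookup (anti_diff i c) = shift i 1 (Poly_Mapping.lookup c)"
proof
  fix j
  let ?c = "Poly_Mapping.lookup c" and ?j = "j(i := Suc (j i))"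
  have "(if k i = 0 then 0 else Poly_Mapping.lookup (Poly_Mapping.single (k(i := k i - 1)) (?c k)) j) =
      (if k = ?j then ?c k else 0)" for k
  proof (cases "k i = 0")
    case False
    have "k(i := k i - 1) = j \<longleftrightarrow> k = ?j"
    proof
      assume "k(i := k i - 1) = j"
      then have "j = k(i := k i - 1)" by simp
      then show "k = ?j" using False by (auto simp: fun_eq_iff)
    qed auto
    then show ?thesis using False by (auto simp: lookup_single when_def)
  qed auto
  then have "Poly_Mapping.lookup (anti_diff i c) j =
      (\<Sum>k\<in>Poly_Mapping.keys c. if k = ?j then ?c k else 0)"
    unfolding anti_diff_def lookup_sum by (auto intro!: sum.cong simp: if_distrib[of "\<lambda>p. Poly_Mapping.lookup p j"] cong: if_cong)
  also have "\<dots> = ?c ?j" by (auto simp: in_keys_iff)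
  finally show "Poly_Mapping.lookup (anti_diff i c) j = shift i 1 ?c j" by (simp add: shift_def)
qed

lemma has_sum_apply_functional:
  "((\<lambda>j. Poly_Mapping.lookup c j * taylor_coeff x f j) has_sum apply_functional c x f) UNIV"
  by (rule has_sum_finite_neutralI[of "Poly_Mapping.keys c"])
     (auto simp: apply_functional_def taylor_coeff_def in_keys_iff)

lemma annihilates_recursion:
  "annihilates u \<Psi> \<longleftrightarrow>
    (\<forall>w\<in>\<Psi>. ((\<lambda>j. u j * w j) has_sum 0) UNIV) \<and> (\<forall>i. annihilates (shift i 1 u) \<Psi>)"
proof safe
  assume u: "annihilates u \<Psi>"
  then show "annihilates (shift i 1 u) \<Psi>" for i by (rule annihilates_shift)
  fix w assume "w \<in> \<Psi>"
  with u have "((\<lambda>j. u (\<lambda>i. j i + (\<lambda>_. 0) i) * w j) has_sum 0) UNIV" by (simp only: annihilates_def)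
  then show "((\<lambda>j. u j * w j) has_sum 0) UNIV" by simp
next
  assume 0: "\<forall>w\<in>\<Psi>. ((\<lambda>j. u j * w j) has_sum 0) UNIV" and s: "\<forall>i. annihilates (shift i 1 u) \<Psi>"
  show "annihilates u \<Psi>"
    unfolding annihilates_def
  proof (intro ballI allI)
    fix w and m :: "'a \<Rightarrow> nat" assume w: "w \<in> \<Psi>"
    show "((\<lambda>j. u (\<lambda>i. j i + m i) * w j) has_sum 0) UNIV"
    proof (cases "m = (\<lambda>_. 0)")
      case True
      then show ?thesis using 0 w by simp
    next
      case False
      then obtain i where i: "m i > 0" by (auto simp: fun_eq_iff)
      let ?m = "m(i := m i - 1)"
      have "((\<lambda>j. shift i 1 u (\<lambda>k. j k + ?m k) * w j) has_sum 0) UNIV"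
        using s w by (simp only: annihilates_def)
      moreover have "shift i 1 u (\<lambda>k. j k + ?m k) = u (\<lambda>k. j k + m k)" for j
        unfolding shift_def by (rule arg_cong[of _ _ u]) (use i in auto)
      ultimately show ?thesis by simp
    qed
  qed
qed

text \<open>
  Unfolding the recursion: the condition on all \<open>\<phi>\<^sub>i(c)\<close> prescribes the same vanishing for every iterated shift of \<open>c\<close>.
  For \<open>\<alpha> = 0\<close> the recursion does not ask that \<open>c\<close> kills \<open>F\<close>; the assumption on the constant coefficients supplies this.
\<close>

lemma dual_space_iff:
  fixes x :: "complex ^ 's::{finite,linorder}"
  assumes zero: "\<And>f. f \<in> F \<Longrightarrow> taylor_coeff x f (\<lambda>_. 0) = 0" and F: "F \<noteq> {}"
  shows "c \<in> dual_space x F \<alpha> \<longleftrightarrow>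
    (\<forall>j\<in>Poly_Mapping.keys c. order_of j \<le> \<alpha>) \<and> annihilates (Poly_Mapping.lookup c) (taylor_coeff x ` F)"
proof (induction \<alpha> arbitrary: c)
  case 0
  let ?c = "Poly_Mapping.lookup c"
  have order_0: "order_of j = 0 \<longleftrightarrow> j = (\<lambda>_. 0)" for j :: "'s \<Rightarrow> nat" by (auto simp: fun_eq_iff)
  show ?case
  proof
    assume "c \<in> dual_space x F 0"
    then obtain a where c: "c = scale_functional a (Poly_Mapping.single (\<lambda>_. 0) 1)"
      by (auto simp: functional.span_singleton)
    then have supp: "?c j = 0" if "j \<noteq> (\<lambda>_. 0)" for j using that by (simp add: lookup_single_not_eq)
    have "?c (\<lambda>i. j i + m i) * taylor_coeff x f j = 0" if "f \<in> F" for f j m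
    proof (cases "j = (\<lambda>_. 0)")
      case False
      then have "(\<lambda>i. j i + m i) \<noteq> (\<lambda>_. 0)" by (auto simp: fun_eq_iff)
      then show ?thesis using supp by simp
    qed (simp add: zero[OF that])
    then have "annihilates ?c (taylor_coeff x ` F)"
      unfolding annihilates_def by (intro ballI allI has_sum_0) auto
    moreover have "j = (\<lambda>_. 0)" if "j \<in> Poly_Mapping.keys c" for j
      using supp that by (auto simp: in_keys_iff)
    ultimately show "(\<forall>j\<in>Poly_Mapping.keys c. order_of j \<le> 0) \<and> annihilates ?c (taylor_coeff x ` F)"
      by auto
  next
    assume "(\<forall>j\<in>Poly_Mapping.keys c. order_of j \<le> 0) \<and> annihilates ?c (taylor_coeff x ` F)"
    then have "?c j = 0" if "j \<noteq> (\<lambda>_. 0)" for j using that order_0 by (auto simp: in_keys_iff)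
    then have "c = scale_functional (?c (\<lambda>_. 0)) (Poly_Mapping.single (\<lambda>_. 0) 1)"
      by (intro poly_mapping_eqI) (auto simp: lookup_single when_def)
    then show "c \<in> dual_space x F 0" by (auto simp: functional.span_singleton)
  qed
next
  case (Suc \<alpha>)
  let ?c = "Poly_Mapping.lookup c"
  have keys: "(\<forall>j\<in>Poly_Mapping.keys (anti_diff i c). order_of j \<le> \<alpha>)"
    if "\<forall>j\<in>Poly_Mapping.keys c. order_of j \<le> Suc \<alpha>" for i
  proof
    fix j assume "j \<in> Poly_Mapping.keys (anti_diff i c)"
    then have "j(i := Suc (j i)) \<in> Poly_Mapping.keys c"
      by (simp add: in_keys_iff lookup_anti_diff shift_def)
    with that have "order_of (j(i := Suc (j i))) \<le> Suc \<alpha>" by blast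
    then show "order_of j \<le> \<alpha>" by (simp only: order_of_upd Suc_le_mono)
  qed
  have app: "apply_functional c x f = 0 \<longleftrightarrow> ((\<lambda>j. ?c j * taylor_coeff x f j) has_sum 0) UNIV" for f
    using has_sum_apply_functional[of c x f] by (auto dest: has_sum_unique)
  have "c \<in> dual_space x F (Suc \<alpha>) \<longleftrightarrow> (\<forall>j\<in>Poly_Mapping.keys c. order_of j \<le> Suc \<alpha>) \<and>
      (\<forall>f\<in>F. apply_functional c x f = 0) \<and> (\<forall>i. anti_diff i c \<in> dual_space x F \<alpha>)"
    using F by auto
  also have "\<dots> \<longleftrightarrow> (\<forall>j\<in>Poly_Mapping.keys c. order_of j \<le> Suc \<alpha>) \<and>
      (\<forall>f\<in>F. ((\<lambda>j. ?c j * taylor_coeff x f j) has_sum 0) UNIV) \<and> (\<forall>i. annihilates (shift i 1 ?c) (taylor_coeff x ` F))"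
    unfolding Suc.IH app lookup_anti_diff using keys by blast
  also have "\<dots> \<longleftrightarrow> (\<forall>j\<in>Poly_Mapping.keys c. order_of j \<le> Suc \<alpha>) \<and> annihilates ?c (taylor_coeff x ` F)"
    unfolding annihilates_recursion[of ?c] by blast
  finally show ?case .
qed

lemma subspace_dual_space:
  fixes x :: "complex ^ 's::{finite,linorder}"
  assumes zero: "\<And>f. f \<in> F \<Longrightarrow> taylor_coeff x f (\<lambda>_. 0) = 0" and F: "F \<noteq> {}"
  shows "functional.subspace (dual_space x F \<alpha>)"
proof (rule functional.subspaceI)
  note iff = dual_space_iff[OF zero F]
  show "0 \<in> dual_space x F \<alpha>" by (simp add: iff annihilates_def)
  fix c d assume cd: "c \<in> dual_space x F \<alpha>" "d \<in> dual_space x F \<alpha>"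
  have "Poly_Mapping.lookup (c + d) = (\<lambda>j. Poly_Mapping.lookup c j + Poly_Mapping.lookup d j)"
    by (simp add: fun_eq_iff lookup_add)
  then show "c + d \<in> dual_space x F \<alpha>"
    using cd annihilates_add keys_add[of c d] by (auto simp: iff)
next
  note iff = dual_space_iff[OF zero F]
  fix a c assume c: "c \<in> dual_space x F \<alpha>"
  have "Poly_Mapping.lookup (scale_functional a c) = (\<lambda>j. a * Poly_Mapping.lookup c j)" by auto
  then show "scale_functional a c \<in> dual_space x F \<alpha>"
    using c annihilates_scale by (auto simp: iff in_keys_iff)
qed

lemma functional_in_span_symbols:
  assumes "finite A" "Poly_Mapping.keys c \<subseteq> A"
  shows "c \<in> functional.span ((\<lambda>j. Poly_Mapping.single j 1) ` A)"
proof -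
  have "c = (\<Sum>j\<in>A. scale_functional (Poly_Mapping.lookup c j) (Poly_Mapping.single j 1))"
    using assms
    by (intro poly_mapping_eqI)
       (auto simp: lookup_sum lookup_single when_def in_keys_iff if_distrib[of "\<lambda>z. a * z" for a] cong: if_cong)
  also have "\<dots> \<in> functional.span ((\<lambda>j. Poly_Mapping.single j 1) ` A)"
    by (intro functional.span_sum functional.span_scale functional.span_base) auto
  finally show ?thesis .
qed

lemma dim_le_if_determined_on_finite_set:
  fixes D :: "'s diff_functional set"
  assumes D: "functional.subspace D" and A: "finite A"
    and det: "\<And>c. c \<in> D \<Longrightarrow> (\<And>j. j \<in> A \<Longrightarrow> Poly_Mapping.lookup c j = 0) \<Longrightarrow> c = 0"
  shows "functional.dim D \<le> card A"
proof -
  interpret pair: vector_space_pair "scale_functional :: complex \<Rightarrow> 's diff_functional \<Rightarrow> _" scale_functional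
    by unfold_locales
  define p :: "'s diff_functional \<Rightarrow> 's diff_functional"
    where "p = (\<lambda>c. \<Sum>j\<in>A. Poly_Mapping.single j (Poly_Mapping.lookup c j))"
  have lookup_p: "Poly_Mapping.lookup (p c) j = (if j \<in> A then Poly_Mapping.lookup c j else 0)" for c j
    using A by (auto simp: p_def lookup_sum lookup_single when_def)
  have lin: "Vector_Spaces.linear scale_functional scale_functional p"
    by unfold_locales (auto intro!: poly_mapping_eqI simp: lookup_p lookup_add)
  obtain B where B: "B \<subseteq> D" "functional.independent B" "D \<subseteq> functional.span B" "card B = functional.dim D"
    by (rule functional.basis_exists)
  have span: "functional.span B = D" using B D by (metis functional.span_subspace)
  have inj: "inj_on p D"
  proof (rule inj_onI)
    fix c d assume cd: "c \<in> D" "d \<in> D" and "p c = p d"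
    then have "Poly_Mapping.lookup (c - d) j = 0" if "j \<in> A" for j
      using lookup_p[of c j] lookup_p[of d j] that by (simp add: lookup_minus)
    with det[OF functional.subspace_diff[OF D cd]] show "c = d" by simp
  qed
  have "functional.independent (p ` B)"
    by (rule pair.linear_independent_injective_image[OF lin B(2)]) (simp add: span inj)
  moreover have "p ` B \<subseteq> functional.span ((\<lambda>j. Poly_Mapping.single j 1) ` A)"
    using A by (auto intro!: functional_in_span_symbols simp: in_keys_iff lookup_p split: if_splits)
  ultimately have "card (p ` B) \<le> card ((\<lambda>j. Poly_Mapping.single j (1::complex)) ` A)"
    using functional.independent_span_bound A by blast
  also have "\<dots> \<le> card A" using A by (rule card_image_le)
  finally show ?thesis using B card_image[OF inj_on_subset[OF inj B(1)]] by simp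
qed

lemma independent_card_le_dim:
  assumes "functional.independent S" "S \<subseteq> V" "V \<subseteq> functional.span T" "finite T"
  shows "card S \<le> functional.dim V"
proof -
  obtain B where B: "B \<subseteq> V" "functional.independent B" "V \<subseteq> functional.span B" "card B = functional.dim V"
    by (rule functional.basis_exists)
  have "finite B" using functional.independent_span_bound[OF assms(4) B(2)] B assms by blast
  then show ?thesis using functional.independent_span_bound[OF _ assms(1)] B assms by fastforce
qed

text \<open>
  A functional of exact order \<open>n\<close> lies outside the span of functionals of lower order, so each step of the
  chain \<open>\<D>\<^sup>0 \<subseteq> \<D>\<^sup>1 \<subseteq> \<dots>\<close> raises the dimension.
\<close>

lemma dim_dual_space_gt:
  fixes x :: "complex ^ 's::{finite,linorder}"
  assumes zero: "\<And>f. f \<in> F \<Longrightarrow> taylor_coeff x f (\<lambda>_. 0) = 0" and F: "F \<noteq> {}"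
    and top: "\<And>n. \<exists>c\<in>dual_space x F n. \<exists>j\<in>Poly_Mapping.keys c. order_of j = n"
  shows "n < functional.dim (dual_space x F n)"
proof -
  note iff = dual_space_iff[OF zero F]
  let ?D = "dual_space x F"
  have fin: "?D n \<subseteq> functional.span ((\<lambda>j. Poly_Mapping.single j 1) ` {j. order_of j \<le> n})" for n
    by (auto simp: iff intro!: functional_in_span_symbols finite_order_le)
  have step: "Suc (card B) \<le> functional.dim (?D n)"
    if B: "functional.independent B" "finite B" "B \<subseteq> ?D n" "\<And>c j. c \<in> B \<Longrightarrow> j \<in> Poly_Mapping.keys c \<Longrightarrow> order_of j < n" for B n
  proof -
    obtain c j where c: "c \<in> ?D n" "j \<in> Poly_Mapping.keys c" "order_of j = n" using top by blast
    have "functional.subspace {c. Poly_Mapping.lookup c j = 0}"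
      by (rule functional.subspaceI) (auto simp: lookup_add)
    then have "functional.span B \<subseteq> {c. Poly_Mapping.lookup c j = 0}"
      using B(4) c(3) by (intro functional.span_minimal) (auto simp: in_keys_iff)
    then have notin: "c \<notin> functional.span B" using c(2) by (auto simp: in_keys_iff)
    then have "functional.independent (insert c B)" using B(1) by (rule functional.independent_insertI)
    then have "card (insert c B) \<le> functional.dim (?D n)"
      by (rule independent_card_le_dim[OF _ _ fin]) (use B(3) c(1) finite_order_le in auto)
    moreover have "c \<notin> B" using notin functional.span_base by blast
    ultimately show ?thesis using B(2) by simp
  qed
  show ?thesis
  proof (induction n)
    case 0
    then show ?case using step[of "{}" 0] by (simp add: functional.independent_empty)
  next
    case (Suc n)
    obtain B where B: "B \<subseteq> ?D n" "functional.independent B" "?D n \<subseteq> functional.span B" "card B = functional.dim (?D n)"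
      by (rule functional.basis_exists)
    have "?D n \<subseteq> ?D (Suc n)" using iff[of _ n] iff[of _ "Suc n"] by (meson le_SucI subsetI)
    moreover have "finite B" 
      using functional.independent_span_bound[OF finite_imageI[OF finite_order_le] B(2) order_trans[OF B(1) fin]]
      by simp
    ultimately have "Suc (card B) \<le> functional.dim (?D (Suc n))"
      using B by (intro step) (auto simp: iff less_Suc_eq_le subset_iff simp del: dual_space.simps)
    then show ?case using Suc B by simp
  qed
qed

section \<open>Isolated zeros have bounded dual dimension\<close>

text \<open>
  The factor \<open>\<rho>\<close> rescales a small closed polydisc without further zeros to the unit polydisc. A functional \<open>c\<close> becomes the bounded
  family with entries \<open>c\<^sub>j / \<rho>\<^sup>|\<^sup>j\<^sup>|\<close>, and the box found for all bounded annihilators serves every \<open>\<alpha>\<close> at once.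
\<close>

theorem dim_dual_space_bounded_if_isolated:
  fixes x :: "complex ^ 's::{finite,linorder}"
  assumes "open \<Omega>" "finite F" "F \<noteq> {}" and an: "\<And>f. f \<in> F \<Longrightarrow> f mv_analytic_on \<Omega>"
    and x: "x \<in> common_zeros \<Omega> F" and iso: "x isolated_in common_zeros \<Omega> F"
  shows "\<exists>d. \<forall>\<alpha>. functional.dim (dual_space x F \<alpha>) \<le> d"
proof -
  have x\<Omega>: "x \<in> \<Omega>" and fx: "\<And>f. f \<in> F \<Longrightarrow> f x = 0" using x by (auto simp: common_zeros_def)
  obtain r where r: "r > 0" and ps: "\<And>f. f \<in> F \<Longrightarrow> has_power_series f (taylor_coeff x f) x r"
    by (rule common_taylor_expansion[OF assms(2) an x\<Omega>]) auto
  have zero: "taylor_coeff x f (\<lambda>_. 0) = 0" if "f \<in> F" for f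
    using has_power_series_center[OF ps[OF that] r] fx[OF that] by simp
  obtain T where T: "open T" "T \<inter> common_zeros \<Omega> F = {x}" using iso by (rule isolated_inE)
  obtain r' where r': "r' > 0" "\<And>y. (\<And>i. cmod (y $ i - x $ i) < r') \<Longrightarrow> y \<in> T \<inter> \<Omega>"
    using polydisc_in_open[of "T \<inter> \<Omega>" x] T assms(1) x\<Omega> by blast
  define \<rho> where "\<rho> = min r r' / 2"
  have \<rho>: "0 < \<rho>" "\<rho> < r" "\<rho> < r'" using r r' by (auto simp: \<rho>_def)
  define \<psi> where "\<psi> = (\<lambda>f j. taylor_coeff x f j * of_real \<rho> ^ order_of j)"
  have sum: "(\<lambda>j. cmod (w j)) summable_on UNIV" if "w \<in> \<psi> ` F" for w
    using that norm_taylor_summable[OF ps \<rho>(1,2)] \<rho>(1)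
    by (auto simp: \<psi>_def norm_mult norm_power)
  have zeros: "l = (\<lambda>_. 0)" if l: "\<And>i. cmod (l i) \<le> 1"
    and 0: "\<And>w. w \<in> \<psi> ` F \<Longrightarrow> ((\<lambda>j. w j * (\<Prod>i\<in>UNIV. l i ^ j i)) has_sum 0) UNIV" for l
  proof -
    let ?y = "x + (\<chi> i. of_real \<rho> * l i)"
    have le: "cmod (of_real \<rho> * l i) \<le> \<rho>" for i
      using \<rho> l[of i] by (simp add: norm_mult mult_left_le)
    have near: "cmod (?y $ i - x $ i) < r" "cmod (?y $ i - x $ i) < r'" for i
      using le[of i] \<rho> by simp_all
    have "f ?y = 0" if "f \<in> F" for f
    proof -
      have "((\<lambda>j. taylor_coeff x f j * (\<Prod>i\<in>UNIV. (?y $ i - x $ i) ^ j i)) has_sum f ?y) UNIV"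
        by (rule ps[OF that, unfolded has_power_series_def, rule_format]) (rule near)
      moreover have "taylor_coeff x f j * (\<Prod>i\<in>UNIV. (?y $ i - x $ i) ^ j i) = \<psi> f j * (\<Prod>i\<in>UNIV. l i ^ j i)" for j
        by (simp add: \<psi>_def power_mult_distrib prod.distrib prod_power_const)
      ultimately show ?thesis using 0[of "\<psi> f"] that has_sum_unique by fastforce
    qed
    moreover have "?y \<in> T \<inter> \<Omega>" by (rule r'(2)) (rule near)
    ultimately have "?y \<in> T \<inter> common_zeros \<Omega> F" by (auto simp: common_zeros_def)
    then have "?y = x" using T by blast
    have "l i = 0" for i
    proof -
      have "?y $ i = x $ i" by (simp only: \<open>?y = x\<close>)
      then show ?thesis using \<rho>(1) by simp
    qed
    then show ?thesis by (rule ext)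
  qed
  obtain N :: nat where N: "\<forall>u. bdd_family u \<longrightarrow> annihilates u (\<psi> ` F) \<longrightarrow>
      (\<forall>j. (\<forall>i. j i < N) \<longrightarrow> u j = 0) \<longrightarrow> u = (\<lambda>_. 0)"
  proof (rule exE[OF annihilator_determined_on_box[of "\<psi> ` F"]])
    fix l assume l: "\<And>i. cmod (l i) \<le> 1"
      and 0: "\<And>w. w \<in> \<psi> ` F \<Longrightarrow> ((\<lambda>j. w j * (\<Prod>i\<in>UNIV. l i ^ j i)) has_sum 0) UNIV"
    show "l = (\<lambda>_. 0)" by (rule zeros[OF l]) (erule 0)
  qed (erule sum, rule that)
  let ?box = "{j :: 's \<Rightarrow> nat. \<forall>i. j i < N}"
  have "?box = PiE UNIV (\<lambda>_. {..<N})" by auto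
  then have box: "finite ?box" by (simp add: finite_PiE)
  have "functional.dim (dual_space x F \<alpha>) \<le> card ?box" for \<alpha>
  proof (rule dim_le_if_determined_on_finite_set[OF subspace_dual_space[OF zero \<open>F \<noteq> {}\<close>] box])
    fix c assume c: "c \<in> dual_space x F \<alpha>" and c0: "\<And>j. j \<in> ?box \<Longrightarrow> Poly_Mapping.lookup c j = 0"
    define u where "u = (\<lambda>j. Poly_Mapping.lookup c j / of_real \<rho> ^ order_of j)"
    have "range (\<lambda>j. cmod (u j)) \<subseteq> insert 0 ((\<lambda>j. cmod (u j)) ` Poly_Mapping.keys c)"
      by (auto simp: u_def in_keys_iff)
    then have "finite (range (\<lambda>j. cmod (u j)))" by (rule finite_subset) simp
    then have "bdd_family u" by (simp add: bdd_family_def)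
    moreover have "annihilates u (\<psi> ` F)"
      unfolding annihilates_def
    proof (intro ballI allI)
      fix w m assume "w \<in> \<psi> ` F"
      then obtain f where f: "f \<in> F" "w = \<psi> f" by blast
      have "annihilates (Poly_Mapping.lookup c) (taylor_coeff x ` F)"
        using c by (simp only: dual_space_iff[OF zero \<open>F \<noteq> {}\<close>])
      then have "((\<lambda>j. Poly_Mapping.lookup c (\<lambda>i. j i + m i) * taylor_coeff x f j) has_sum 0) UNIV"
        using f by (simp add: annihilates_def)
      from has_sum_cmult_right[OF this, of "1 / of_real \<rho> ^ order_of m"]
      show "((\<lambda>j. u (\<lambda>i. j i + m i) * w j) has_sum 0) UNIV"
        using \<rho>(1) by (simp add: u_def f \<psi>_def order_of_add power_add)
    qed
    moreover have "\<forall>j. (\<forall>i. j i < N) \<longrightarrow> u j = 0" using c0 by (simp add: u_def)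
    ultimately have "u = (\<lambda>_. 0)" using N by blast
    then have "Poly_Mapping.lookup c j = 0" for j
      using \<rho>(1) by (simp add: u_def fun_eq_iff)
    then show "c = 0" by (intro poly_mapping_eqI) simp
  qed
  then show ?thesis by blast
qed

section \<open>Bounded dual dimension isolates the zero\<close>

text \<open>
  The product of \<open>f\<close> with the monomial of exponent \<open>m\<close>, cut off above degree \<open>n\<close>. Polynomials are stored in the type of
  differential functionals, with \<open>\<partial>\<^sub>j\<close> standing for the monomial of exponent \<open>j\<close>, so that a
  single vector space structure serves both sides of the duality.
\<close>

definition truncated_multiple ::
    "complex ^ 's::{finite,linorder} \<Rightarrow> nat \<Rightarrow> 's multiindex \<Rightarrow> (complex ^ 's::{finite,linorder} \<Rightarrow> complex) \<Rightarrow> 's diff_functional" where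
  "truncated_multiple x n m f =
    (\<Sum>j\<in>{j. order_of j + order_of m \<le> n}. Poly_Mapping.single (\<lambda>i. j i + m i) (taylor_coeff x f j))"

lemma finite_order_add_le: "finite {j :: 's::finite \<Rightarrow> nat. order_of j + k \<le> n}"
  by (rule finite_subset[OF _ finite_order_le[of n]]) auto

lemma complex_vector_space: "vector_space ((*) :: complex \<Rightarrow> complex \<Rightarrow> complex)"
  by unfold_locales (simp_all add: distrib_left distrib_right)

text \<open>
  A monomial outside the span would be separated from it by a linear form \<open>g\<close>. The values of \<open>g\<close> on monomials are
  the coefficients of a functional: it has order at most \<open>n\<close> because \<open>g\<close> vanishes on higher monomials, it lies in the dual
  space because \<open>g\<close> vanishes on the truncated multiples, and its coefficient at \<open>k\<close> is 1, against \<open>no_top\<close>.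
\<close>

lemma monomial_in_span_truncated_multiples:
  fixes x :: "complex ^ 's::{finite,linorder}"
  assumes zero: "\<And>f. f \<in> F \<Longrightarrow> taylor_coeff x f (\<lambda>_. 0) = 0" and F: "F \<noteq> {}"
    and no_top: "\<And>c j. c \<in> dual_space x F n \<Longrightarrow> j \<in> Poly_Mapping.keys c \<Longrightarrow> order_of j \<noteq> n"
    and k: "order_of k = n"
  shows "Poly_Mapping.single k 1 \<in> functional.span
    ({truncated_multiple x n m f |m f. f \<in> F} \<union> {Poly_Mapping.single j 1 |j. n < order_of j})"
    (is "?e \<in> functional.span ?W")
proof (rule ccontr)
  assume notin: "?e \<notin> functional.span ?W"
  interpret pair: vector_space_pair "scale_functional :: complex \<Rightarrow> 's diff_functional \<Rightarrow> _" "(*) :: complex \<Rightarrow> _"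
    by (intro vector_space_pair.intro functional.vector_space_axioms complex_vector_space)
  obtain B where B: "B \<subseteq> ?W" "functional.independent B" "?W \<subseteq> functional.span B"
    by (rule functional.maximal_independent_subset)
  have e: "?e \<notin> functional.span B" using notin functional.span_mono[OF B(1)] by blast
  then obtain g where g: "Vector_Spaces.linear scale_functional (*) g"
    and gB: "\<forall>b\<in>insert ?e B. g b = (if b = ?e then 1 else 0)"
    using pair.linear_independent_extend[OF functional.independent_insertI[OF e B(2)],
        of "\<lambda>b. if b = ?e then 1 else 0"] by blast
  have add: "g (a + b) = g a + g b" and scale: "g (scale_functional t a) = t * g a" for a b t
    using g by (simp_all add: pair.linear_add pair.linear_scale)
  have "functional.subspace {v. g v = 0}"
    using add scale[of 0 0] scale by (intro functional.subspaceI) auto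
  moreover have "g b = 0" if "b \<in> B" for b
    using gB e functional.span_base[OF that] that by auto
  ultimately have "functional.span B \<subseteq> {v. g v = 0}"
    by (intro functional.span_minimal) auto
  then have gW: "g w = 0" if "w \<in> ?W" for w using B(3) that by blast
  have g_single: "g (Poly_Mapping.single j a) = a * g (Poly_Mapping.single j 1)" for j a
  proof -
    have "Poly_Mapping.single j a = scale_functional a (Poly_Mapping.single j 1)"
      by (intro poly_mapping_eqI) (simp add: lookup_single when_def)
    then show ?thesis using scale by simp
  qed
  have g_sum: "g (sum h A) = (\<Sum>a\<in>A. g (h a))" if "finite A" for h :: "('s \<Rightarrow> nat) \<Rightarrow> _" and A
    using that by (induction A rule: finite_induct) (use add scale[of 0 0] in auto)
  define c where "c = (\<Sum>j\<in>{j. order_of j \<le> n}. Poly_Mapping.single j (g (Poly_Mapping.single j 1)))"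
  have lookup_c: "Poly_Mapping.lookup c j = (if order_of j \<le> n then g (Poly_Mapping.single j 1) else 0)" for j
    by (simp add: c_def lookup_sum lookup_single when_def finite_order_le)
  have "annihilates (Poly_Mapping.lookup c) (taylor_coeff x ` F)"
    unfolding annihilates_def
  proof (intro ballI allI)
    fix w and m :: "'s \<Rightarrow> nat" assume "w \<in> taylor_coeff x ` F"
    then obtain f where f: "f \<in> F" "w = taylor_coeff x f" by blast
    let ?A = "{j :: 's \<Rightarrow> nat. order_of j + order_of m \<le> n}"
    show "((\<lambda>j. Poly_Mapping.lookup c (\<lambda>i. j i + m i) * w j) has_sum 0) UNIV"
    proof (rule has_sum_finite_neutralI[of ?A])
      have "0 = g (truncated_multiple x n m f)" using gW f by auto
      also have "\<dots> = (\<Sum>j\<in>?A. Poly_Mapping.lookup c (\<lambda>i. j i + m i) * w j)"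
        unfolding truncated_multiple_def g_sum[OF finite_order_add_le]
        by (intro sum.cong refl) (subst g_single, simp add: lookup_c order_of_add f)
      finally show "0 = (\<Sum>j\<in>?A. Poly_Mapping.lookup c (\<lambda>i. j i + m i) * w j)" .
    qed (auto simp: lookup_c order_of_add finite_order_add_le)
  qed
  moreover have "order_of j \<le> n" if "j \<in> Poly_Mapping.keys c" for j
    using that by (auto simp: in_keys_iff lookup_c split: if_splits)
  ultimately have "c \<in> dual_space x F n" by (simp only: dual_space_iff[OF zero F]) blast
  moreover have "k \<in> Poly_Mapping.keys c"
    using gB k by (simp add: in_keys_iff lookup_c)
  ultimately show False using no_top k by blast
qed

text \<open>
  Splitting off exactly \<open>n + 1\<close> factors \<open>t\<close> and bounding the others by \<open>r\<close> leaves a factor that a series converging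
  at radius \<open>r\<close> can be summed against.
\<close>

lemma monomial_bound:
  assumes "\<And>i. cmod (z i) \<le> t" "0 \<le> t" "t \<le> r" "0 < r" "n < order_of (j :: 's::finite \<Rightarrow> nat)"
  shows "cmod (\<Prod>i\<in>UNIV. z i ^ j i) \<le> r ^ order_of j / r ^ Suc n * t ^ Suc n"
proof -
  have "cmod (\<Prod>i\<in>UNIV. z i ^ j i) \<le> (\<Prod>i\<in>UNIV. t ^ j i)"
    unfolding prod_norm[symmetric] norm_power by (intro prod_mono) (use assms in \<open>auto intro: power_mono\<close>)
  also have "\<dots> = t ^ (order_of j - Suc n) * t ^ Suc n"
    using assms(5) by (simp only: prod_power_const power_add[symmetric]) simp
  also have "\<dots> \<le> r ^ (order_of j - Suc n) * t ^ Suc n"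
    using assms by (intro mult_right_mono power_mono) auto
  also have "r ^ (order_of j - Suc n) = r ^ order_of j / r ^ Suc n"
    using assms by (intro power_diff) auto
  finally show ?thesis .
qed

text \<open>
  At a common zero \<open>z\<close> the full multiple \<open>y\<^sup>m f\<close> vanishes, so its truncation equals minus its tail, which has order
  above \<open>n\<close>. The value \<open>s\<close> of the polynomial is given through \<open>has_sum\<close> because in this form it is visibly additive.
\<close>

lemma span_truncated_multiples_small_at_zeros:
  fixes x :: "complex ^ 's::{finite,linorder}"
  assumes ps: "\<And>f. f \<in> F \<Longrightarrow> has_power_series f (taylor_coeff x f) x R" and r: "0 < r" "r < R"
    and v: "v \<in> functional.span
      ({truncated_multiple x n m f |m f. f \<in> F} \<union> {Poly_Mapping.single j 1 |j. n < order_of j})"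
  shows "\<exists>C. \<forall>z t. 0 \<le> t \<longrightarrow> t \<le> r \<longrightarrow> (\<forall>i. cmod (z i) \<le> t) \<longrightarrow> (\<forall>f\<in>F. f (x + (\<chi> i. z i)) = 0) \<longrightarrow>
    (\<exists>s. ((\<lambda>j. Poly_Mapping.lookup v j * (\<Prod>i\<in>UNIV. z i ^ j i)) has_sum s) UNIV \<and> cmod s \<le> C * t ^ Suc n)"
    (is "\<exists>C. \<forall>z t. ?A t \<longrightarrow> ?B t \<longrightarrow> ?P z t \<longrightarrow> ?Z z \<longrightarrow> ?Q v C z t")
  using v
proof (induction rule: functional.span_induct_alt)
  case base
  have "?Q 0 0 z t" for z t by (auto intro!: exI[of _ 0])
  then show ?case by blast
next
  case (step a w v)
  have single: "((\<lambda>j. Poly_Mapping.lookup (Poly_Mapping.single k b) j * (\<Prod>i\<in>UNIV. z i ^ j i)) has_sum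
      b * (\<Prod>i\<in>UNIV. z i ^ k i)) UNIV" for z :: "'s \<Rightarrow> complex" and k b
    by (rule has_sum_finite_neutralI[of "{k}"]) (auto simp: lookup_single when_def)
  have "\<exists>C. \<forall>z t. ?A t \<longrightarrow> ?B t \<longrightarrow> ?P z t \<longrightarrow> ?Z z \<longrightarrow> ?Q w C z t"
    using step(1)
  proof
    assume "w \<in> {Poly_Mapping.single j 1 |j. n < order_of j}"
    then obtain k where k: "n < order_of k" "w = Poly_Mapping.single k 1" by blast
    have "?Q w (r ^ order_of k / r ^ Suc n) z t" if "?A t" "?B t" "?P z t" "?Z z" for z t
      using single[of k 1 z] monomial_bound[of z t r n k] that k r by auto
    then show ?thesis by blast
  next
    assume "w \<in> {truncated_multiple x n m f |m f. f \<in> F}"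
    then obtain m f where f: "f \<in> F" and w: "w = truncated_multiple x n m f" by blast
    let ?J = "{j :: 's \<Rightarrow> nat. order_of j + order_of m \<le> n}"
    define S where "S = (\<Sum>\<^sub>\<infinity>j\<in>-?J. cmod (taylor_coeff x f j) * r ^ order_of j)"
    define C where "C = r ^ order_of m / r ^ Suc n * S"
    have summ: "(\<lambda>j. cmod (taylor_coeff x f j) * r ^ order_of j) summable_on -?J"
      by (rule summable_on_subset_banach[OF norm_taylor_summable[OF ps[OF f] r]]) simp
    have "?Q w C z t" if t: "?A t" "?B t" and z: "?P z t" and Z: "?Z z" for z t
    proof -
      let ?mon = "\<lambda>j. \<Prod>i\<in>UNIV. z i ^ j i"
      let ?jm = "\<lambda>j i. j i + m i"
      have mon: "?mon (?jm j) = ?mon m * ?mon j" for j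
        by (simp add: power_add prod.distrib mult.commute)
      have sum_fin: "((\<lambda>j. Poly_Mapping.lookup (\<Sum>k\<in>A. Poly_Mapping.single (?jm k) (taylor_coeff x f k)) j * ?mon j) has_sum
          (\<Sum>k\<in>A. taylor_coeff x f k * ?mon (?jm k))) UNIV" if "finite A" for A
        using that
      proof (induction A rule: finite_induct)
        case (insert k A)
        then show ?case
          using has_sum_add[OF single[of "?jm k" "taylor_coeff x f k" z] insert.IH]
          by (simp add: lookup_add distrib_right)
      qed simp
      have "((\<lambda>j. taylor_coeff x f j * (\<Prod>i\<in>UNIV. ((x + (\<chi> i. z i)) $ i - x $ i) ^ j i)) has_sum f (x + (\<chi> i. z i))) UNIV"
        by (rule ps[OF f, unfolded has_power_series_def, rule_format]) (use z t r in \<open>auto intro: le_less_trans\<close>)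
      then have full: "((\<lambda>j. taylor_coeff x f j * ?mon j) has_sum 0) UNIV" by (simp add: bspec[OF Z f])
      have "((\<lambda>j. ?mon m * (taylor_coeff x f j * ?mon j)) has_sum ?mon m * 0) UNIV"
        by (rule has_sum_cmult_right[OF full])
      then have full': "((\<lambda>j. taylor_coeff x f j * ?mon (?jm j)) has_sum 0) UNIV"
        by (simp add: mon mult.left_commute)
      have fin: "((\<lambda>j. taylor_coeff x f j * ?mon (?jm j)) has_sum (\<Sum>k\<in>?J. taylor_coeff x f k * ?mon (?jm k))) ?J"
        using finite_order_add_le by (rule has_sum_finiteI) simp
      have tail: "((\<lambda>j. taylor_coeff x f j * ?mon (?jm j)) has_sum 0 - (\<Sum>k\<in>?J. taylor_coeff x f k * ?mon (?jm k))) (-?J)"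
        using has_sum_Diff[OF full' fin] by (simp add: Compl_eq_Diff_UNIV)
      have bound: "((\<lambda>j. (r ^ order_of m / r ^ Suc n * t ^ Suc n) * (cmod (taylor_coeff x f j) * r ^ order_of j)) has_sum
          (r ^ order_of m / r ^ Suc n * t ^ Suc n) * S) (-?J)"
        unfolding S_def by (intro has_sum_cmult_right has_sum_infsum summ)
      have "cmod (0 - (\<Sum>k\<in>?J. taylor_coeff x f k * ?mon (?jm k))) \<le> (r ^ order_of m / r ^ Suc n * t ^ Suc n) * S"
      proof (rule norm_infsum_le[OF tail bound])
        fix j assume "j \<in> -?J"
        then have "n < order_of (?jm j)" by (simp add: order_of_add)
        then have "cmod (?mon (?jm j)) \<le> r ^ order_of (?jm j) / r ^ Suc n * t ^ Suc n"
          using z t r by (intro monomial_bound) auto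
        then have "cmod (taylor_coeff x f j) * cmod (?mon (?jm j)) \<le>
            cmod (taylor_coeff x f j) * (r ^ order_of (?jm j) / r ^ Suc n * t ^ Suc n)" by (rule mult_left_mono) simp
        then show "norm (taylor_coeff x f j * ?mon (?jm j)) \<le>
            (r ^ order_of m / r ^ Suc n * t ^ Suc n) * (cmod (taylor_coeff x f j) * r ^ order_of j)"
          unfolding norm_mult order_of_add power_add by (simp add: mult_ac)
      qed
      then have "cmod (\<Sum>k\<in>?J. taylor_coeff x f k * ?mon (?jm k)) \<le> C * t ^ Suc n"
        by (simp add: C_def mult_ac)
      then show ?thesis
        using sum_fin[OF finite_order_add_le] unfolding w truncated_multiple_def by blast
    qed
    then show ?thesis by blast
  qed
  then obtain C1 where C1: "\<And>z t. ?A t \<Longrightarrow> ?B t \<Longrightarrow> ?P z t \<Longrightarrow> ?Z z \<Longrightarrow> ?Q w C1 z t" by blast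
  obtain C2 where C2: "\<And>z t. ?A t \<Longrightarrow> ?B t \<Longrightarrow> ?P z t \<Longrightarrow> ?Z z \<Longrightarrow> ?Q v C2 z t" using step(2) by blast
  have "?Q (scale_functional a w + v) (cmod a * C1 + C2) z t" if at: "?A t" "?B t" "?P z t" "?Z z" for z t
  proof -
    let ?mon = "\<lambda>j. \<Prod>i\<in>UNIV. z i ^ j i"
    obtain s1 where s1: "((\<lambda>j. Poly_Mapping.lookup w j * ?mon j) has_sum s1) UNIV" "cmod s1 \<le> C1 * t ^ Suc n"
      using C1[OF at] by blast
    obtain s2 where s2: "((\<lambda>j. Poly_Mapping.lookup v j * ?mon j) has_sum s2) UNIV" "cmod s2 \<le> C2 * t ^ Suc n"
      using C2[OF at] by blast
    have "((\<lambda>j. a * (Poly_Mapping.lookup w j * ?mon j) + Poly_Mapping.lookup v j * ?mon j) has_sum a * s1 + s2) UNIV"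
      by (intro has_sum_add has_sum_cmult_right s1 s2)
    moreover have "cmod (a * s1 + s2) \<le> cmod a * (C1 * t ^ Suc n) + C2 * t ^ Suc n"
      using s1(2) s2(2) by (intro norm_triangle_mono) (auto simp: norm_mult mult_left_mono)
    ultimately show ?thesis
      by (intro exI[of _ "a * s1 + s2"]) (simp add: lookup_add algebra_simps)
  qed
  then show ?case by blast
qed

text \<open>
  The bound for the \<open>n\<close>-th powers of the coordinates is applied to the coordinate of largest modulus \<open>t\<close>; then
  \<open>t\<^sup>n \<le> K t\<^sup>n\<^sup>+\<^sup>1\<close> leaves no zero with \<open>0 < t < 1/K\<close>.
\<close>

theorem isolated_if_dim_dual_space_bounded:
  fixes x :: "complex ^ 's::{finite,linorder}"
  assumes "finite F" and F: "F \<noteq> {}" and an: "\<And>f. f \<in> F \<Longrightarrow> f mv_analytic_on \<Omega>"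
    and x: "x \<in> common_zeros \<Omega> F" and bounded: "\<And>\<alpha>. functional.dim (dual_space x F \<alpha>) \<le> d"
  shows "x isolated_in common_zeros \<Omega> F"
proof -
  have x\<Omega>: "x \<in> \<Omega>" and fx: "\<And>f. f \<in> F \<Longrightarrow> f x = 0" using x by (auto simp: common_zeros_def)
  obtain R where R: "R > 0" and ps: "\<And>f. f \<in> F \<Longrightarrow> has_power_series f (taylor_coeff x f) x R"
    by (rule common_taylor_expansion[OF assms(1) an x\<Omega>]) auto
  have zero: "taylor_coeff x f (\<lambda>_. 0) = 0" if "f \<in> F" for f
    using has_power_series_center[OF ps[OF that] R] fx[OF that] by simp
  have "\<not> (\<forall>n. \<exists>c\<in>dual_space x F n. \<exists>j\<in>Poly_Mapping.keys c. order_of j = n)"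
    using dim_dual_space_gt[OF zero F, of d] bounded[of d] by fastforce
  then obtain n where no_top: "\<And>c j. c \<in> dual_space x F n \<Longrightarrow> j \<in> Poly_Mapping.keys c \<Longrightarrow> order_of j \<noteq> n"
    by blast
  \<comment> \<open>Any radius strictly below \<open>R\<close> gives absolute convergence on the closed polydisc.\<close>
  define r where "r = R / 2"
  have r: "0 < r" "r < R" using R by (auto simp: r_def)
  let ?k = "\<lambda>i k. if k = i then n else 0 :: nat"
  have "\<exists>C. \<forall>z t. 0 \<le> t \<longrightarrow> t \<le> r \<longrightarrow> (\<forall>i. cmod (z i) \<le> t) \<longrightarrow> (\<forall>f\<in>F. f (x + (\<chi> i. z i)) = 0) \<longrightarrow>
      cmod (z i) ^ n \<le> C * t ^ Suc n" for i :: 's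
  proof -
    have k: "Poly_Mapping.single (?k i) 1 \<in> functional.span
        ({truncated_multiple x n m f |m f. f \<in> F} \<union> {Poly_Mapping.single j 1 |j. n < order_of j})"
    proof (rule monomial_in_span_truncated_multiples)
      show "order_of (?k i) = n" by simp
    qed (fact zero F no_top)+
    have single: "((\<lambda>j. Poly_Mapping.lookup (Poly_Mapping.single (?k i) 1) j * (\<Prod>i\<in>UNIV. z i ^ j i)) has_sum z i ^ n) UNIV"
      for z :: "'s \<Rightarrow> complex"
    proof (rule has_sum_finite_neutralI[of "{?k i}"])
      have "(\<Prod>l\<in>UNIV. z l ^ ?k i l) = (\<Prod>l\<in>UNIV. if l = i then z i ^ n else 1)"
        by (intro prod.cong) auto
      then show "z i ^ n = (\<Sum>j\<in>{?k i}. Poly_Mapping.lookup (Poly_Mapping.single (?k i) 1) j * (\<Prod>i\<in>UNIV. z i ^ j i))"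
        by simp
    qed (auto simp: lookup_single when_def)
    have "\<exists>C. \<forall>z t. 0 \<le> t \<longrightarrow> t \<le> r \<longrightarrow> (\<forall>i. cmod (z i) \<le> t) \<longrightarrow> (\<forall>f\<in>F. f (x + (\<chi> i. z i)) = 0) \<longrightarrow>
        (\<exists>s. ((\<lambda>j. Poly_Mapping.lookup (Poly_Mapping.single (?k i) 1) j * (\<Prod>i\<in>UNIV. z i ^ j i)) has_sum s) UNIV \<and>
          cmod s \<le> C * t ^ Suc n)"
      by (rule span_truncated_multiples_small_at_zeros[OF _ r k]) (fact ps)
    then obtain C where C: "\<And>z t. 0 \<le> t \<Longrightarrow> t \<le> r \<Longrightarrow> (\<forall>i. cmod (z i) \<le> t) \<Longrightarrow> (\<forall>f\<in>F. f (x + (\<chi> i. z i)) = 0) \<Longrightarrow>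
      \<exists>s. ((\<lambda>j. Poly_Mapping.lookup (Poly_Mapping.single (?k i) 1) j * (\<Prod>i\<in>UNIV. z i ^ j i)) has_sum s) UNIV \<and>
        cmod s \<le> C * t ^ Suc n" by blast
    have "cmod (z i) ^ n \<le> C * t ^ Suc n"
      if at: "0 \<le> t" "t \<le> r" "\<forall>i. cmod (z i) \<le> t" "\<forall>f\<in>F. f (x + (\<chi> i. z i)) = 0" for z t
    proof -
      obtain s where s: "((\<lambda>j. Poly_Mapping.lookup (Poly_Mapping.single (?k i) 1) j * (\<Prod>i\<in>UNIV. z i ^ j i)) has_sum s) UNIV"
        "cmod s \<le> C * t ^ Suc n" using C[OF at] by blast
      have "s = z i ^ n" by (rule has_sum_unique[OF s(1) single])
      with s(2) show ?thesis by (simp add: norm_power)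
    qed
    then show ?thesis by blast
  qed
  then obtain C where C: "\<And>i z t. 0 \<le> t \<Longrightarrow> t \<le> r \<Longrightarrow> (\<And>i. cmod (z i) \<le> t) \<Longrightarrow>
      (\<And>f. f \<in> F \<Longrightarrow> f (x + (\<chi> i. z i)) = 0) \<Longrightarrow> cmod (z i) ^ n \<le> C i * t ^ Suc n"
    by metis
  define K where "K = Max (insert 1 (range C))"
  have K: "1 \<le> K" "C i \<le> K" for i unfolding K_def by (rule Max_ge; simp)+
  define e where "e = min r (1 / (2 * K))"
  have e: "0 < e" "e \<le> r" using r K(1) by (auto simp: e_def)
  have "e * K \<le> 1 / (2 * K) * K" using K(1) by (intro mult_right_mono) (auto simp: e_def)
  then have eK: "e * K < 1" using K(1) by simp
  have "y = x" if y: "y \<in> common_zeros \<Omega> F" and near: "dist x y < e" for y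
  proof -
    define z where "z = (\<lambda>i. (y - x) $ i)"
    have zy: "x + (\<chi> i. z i) = y" by (simp add: z_def vec_eq_iff)
    define t where "t = Max (range (\<lambda>i. cmod (z i)))"
    have "t \<in> range (\<lambda>i. cmod (z i))" unfolding t_def by (rule Max_in) auto
    then obtain i where i: "t = cmod (z i)" by blast
    have zt: "cmod (z k) \<le> t" for k unfolding t_def by (rule Max_ge) auto
    have "cmod (z i) \<le> norm (y - x)" unfolding z_def by (rule Finite_Cartesian_Product.norm_nth_le)
    then have te: "t < e" using near i by (simp add: dist_norm norm_minus_commute)
    have t0: "0 \<le> t" using i by simp
    have "t ^ n \<le> C i * t ^ Suc n"
      using C[of t z i] t0 te e zt y i by (auto simp: zy common_zeros_def)
    also have "\<dots> \<le> K * t ^ Suc n" using K t0 by (intro mult_right_mono) auto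
    also have "\<dots> = (t * K) * t ^ n" by simp
    finally have le: "t ^ n \<le> (t * K) * t ^ n" .
    have "t * K \<le> e * K" using te K(1) by (intro mult_right_mono) auto
    then have "t * K < 1" using eK by simp
    have "t = 0"
    proof (rule ccontr)
      assume "t \<noteq> 0"
      then have "t ^ n > 0" using t0 by simp
      then have "(t * K) * t ^ n < 1 * t ^ n" using \<open>t * K < 1\<close> by (intro mult_strict_right_mono)
      with le show False by simp
    qed
    then have "z k = 0" for k using zt[of k] by simp
    then show "y = x" using zy by (simp add: vec_eq_iff)
  qed
  then show ?thesis unfolding isolated_in_dist_Ex_iff using x e by blast
qed

section \<open>The criterion\<close>

lemma SUP_enat_finite_iff: "(SUP \<alpha>. enat (g \<alpha>)) < \<infinity> \<longleftrightarrow> (\<exists>d. \<forall>\<alpha>. g \<alpha> \<le> d)"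
proof
  assume "(SUP \<alpha>. enat (g \<alpha>)) < \<infinity>"
  then obtain d where d: "(SUP \<alpha>. enat (g \<alpha>)) = enat d" by (auto simp: less_infinityE)
  have "enat (g \<alpha>) \<le> enat d" for \<alpha> unfolding d[symmetric] by (rule SUP_upper) simp
  then show "\<exists>d. \<forall>\<alpha>. g \<alpha> \<le> d" by auto
next
  assume "\<exists>d. \<forall>\<alpha>. g \<alpha> \<le> d"
  then obtain d where "\<And>\<alpha>. g \<alpha> \<le> d" by blast
  then have "(SUP \<alpha>. enat (g \<alpha>)) \<le> enat d" by (intro SUP_least) simp
  then show "(SUP \<alpha>. enat (g \<alpha>)) < \<infinity>" by (rule le_less_trans) simp
qed

theorem theorem1:
  fixes \<Omega> :: "(complex ^ 's::{finite,linorder}) set"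
    and F :: "(complex ^ 's::{finite,linorder} \<Rightarrow> complex) set"
    and x :: "complex ^ 's::{finite,linorder}"
  assumes "open \<Omega>"
    and "finite F" and "F \<noteq> {}"
    and "\<And>f. f \<in> F \<Longrightarrow> f mv_analytic_on \<Omega>"
    and "x \<in> common_zeros \<Omega> F"
  shows "x isolated_in common_zeros \<Omega> F \<longleftrightarrow>
    (SUP \<alpha>. enat (functional.dim (dual_space x F \<alpha>))) < \<infinity>"
  unfolding SUP_enat_finite_iff
proof
  assume "x isolated_in common_zeros \<Omega> F"
  with assms show "\<exists>d. \<forall>\<alpha>. functional.dim (dual_space x F \<alpha>) \<le> d"
    by (rule dim_dual_space_bounded_if_isolated)
next
  assume "\<exists>d. \<forall>\<alpha>. functional.dim (dual_space x F \<alpha>) \<le> d"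
  then obtain d where "\<And>\<alpha>. functional.dim (dual_space x F \<alpha>) \<le> d" by blast
  with assms(2-5) show "x isolated_in common_zeros \<Omega> F"
    by (rule isolated_if_dim_dual_space_bounded)
qed

end
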